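(* Let $\mathcal C^{\mathrm{cvx,bd}}_\infty$ be the class of convex functions $f:\mathcal H_\infty\to\mathbb R$ with $\mathbf{dist}(\mathbf 0,\arg\min f)\le1$ and $-1\le f^\star\le f(\mathbf 0)\le1$. Let $\rho:[1,\infty)\to(0,1]$ be a decreasing bijection. Then for any $\delta\in(0,\tfrac12]$ the following two statements hold. (i) (Nonsmooth case) There exists a probability measure $\mathcal D^{\mathrm{ns}}_\delta$ on the set $\mathcal F^{\mathrm{ns}}_\infty$ of those $f\in\mathcal C^{\mathrm{cvx,bd}}_\infty$ that are $1$-Lipschitz, such that for any randomized first-order algorithm $\mathrm A\in\mathcal A^{(1)}_{\mathrm{rand}}$, $$\mathbb P_{\mathrm A,\,F\sim\mathcal D^{\mathrm{ns}}_\delta}\left(\limsup_{n\to\infty}\frac{\sqrt n\,\big(F(\mathrm A[F]_n)-F^\star\big)}{\rho(n)}\ge1\right)\ge1-2\delta .$$ (ii) (Smooth case) There exists a probability measure $\mathcal D^{\mathrm{sm}}_\delta$ on the set $\mathcal F^{\mathrm{sm}}_\infty$ of those $f\in\mathcal C^{\mathrm{cvx,bd}}_\infty$ that are continuously differentiable with $1$-Lipschitz gradient, such that for any randomized first-order algorithm $\mathrm A\in\mathcal A^{(1)}_{\mathrm{rand}}$, $$\mathbb P_{\mathrm A,\,F\sim\mathcal D^{\mathrm{sm}}_\delta}\left(\limsup_{n\to\infty}\frac{n^2\,\big(F(\mathrm A[F]_n)-F^\star\big)}{\rho(n)}\ge1\right)\ge1-2\delta .$$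
   Context: $\mathbb N=\{1,2,\dots\}$. $\mathcal H_\infty$ is an infinite-dimensional real Hilbert space (i.e. $\ell^2$). $f^\star:=\inf f$. $\mathbf{dist}(x,S)=\inf_{y\in S}\|x-y\|$, equal to $\infty$ if $S=\emptyset$. Randomized first-order algorithms: $\mathrm A\in\mathcal A_{\mathrm{rand}}^{(1)}$ if it produces iterates $x^{(t)}=\mathrm A^{(t)}\big(\xi,(f(x^{(1)}),\nabla f(x^{(1)})),\dots,(f(x^{(t-1)}),\nabla f(x^{(t-1)}))\big)$, $t\in\mathbb N$, with $\mathrm A^{(t)}$ measurable maps into $\mathcal H_\infty$ and $\xi\sim\mathsf{Unif}[0,1]$ drawn independently of $f$. When $f$ is convex and nondifferentiable, $\nabla f$ denotes an arbitrary function with $\nabla f(x)\in\partial f(x)$. $\mathrm A[f]_n:=x^{(n+1)}$ is the output after $n$ oracle calls (dependence on $\xi$ implicit). Probabilities are over the seed $\xi$ and the independent draw of $F$. *)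

theory Defs
  imports "HOL-Probability.Probability"
begin

definition argmin :: "('a \<Rightarrow> real) \<Rightarrow> 'a set" where
  "argmin f = {x. is_arg_min f (\<lambda>_. True) x}"

text \<open>Extended-real valued, so that the distance to the empty set is \<open>\<infinity>\<close>; the library's
  \<^const>\<open>infdist\<close> is \<open>0\<close> there.\<close>

definition edist_set :: "'a::real_normed_vector \<Rightarrow> 'a set \<Rightarrow> ereal" where
  "edist_set x S = (INF y\<in>S. ereal (norm (x - y)))"

text \<open>A real-valued infimum, meaningful only if \<open>f\<close> is bounded below. This is the case whenever
  \<open>argmin f \<noteq> {}\<close>, in particular on all the classes below.\<close>

definition inf_val :: "('a \<Rightarrow> real) \<Rightarrow> real" where
  "inf_val f = (INF x. f x)"

definition cvx_bd :: "('a::real_inner \<Rightarrow> real) set" where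
  "cvx_bd = {f. convex_on UNIV f \<and> edist_set 0 (argmin f) \<le> 1 \<and>
                -1 \<le> inf_val f \<and> inf_val f \<le> f 0 \<and> f 0 \<le> 1}"

definition nonsmooth_class :: "('a::real_inner \<Rightarrow> real) set" where
  "nonsmooth_class = {f \<in> cvx_bd. 1-lipschitz_on UNIV f}"

definition smooth_class :: "('a::real_inner \<Rightarrow> real) set" where
  "smooth_class = {f \<in> cvx_bd. \<exists>g. (\<forall>x. GDERIV f x :> g x) \<and>
                      continuous_on UNIV g \<and> 1-lipschitz_on UNIV g}"

definition subdifferential :: "('a::real_inner \<Rightarrow> real) \<Rightarrow> 'a \<Rightarrow> 'a set" where
  "subdifferential f x = {v. \<forall>y. f y \<ge> f x + v \<bullet> (y - x)}"

text \<open>The map \<open>G\<close> plays the role of \<open>\<nabla>\<close>: \<open>G f x\<close> is what the oracle returns for \<open>f\<close> at \<open>x\<close>. A selection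
  of subgradients is otherwise arbitrary; in particular it need not be measurable.\<close>

definition subgradient_selection ::
    "('a::real_inner \<Rightarrow> real) set \<Rightarrow> (('a \<Rightarrow> real) \<Rightarrow> 'a \<Rightarrow> 'a) \<Rightarrow> bool" where
  "subgradient_selection \<F> G \<longleftrightarrow> (\<forall>f\<in>\<F>. \<forall>x. G f x \<in> subdifferential f x)"

definition gradient_map ::
    "('a::real_inner \<Rightarrow> real) set \<Rightarrow> (('a \<Rightarrow> real) \<Rightarrow> 'a \<Rightarrow> 'a) \<Rightarrow> bool" where
  "gradient_map \<F> G \<longleftrightarrow> (\<forall>f\<in>\<F>. \<forall>x. GDERIV f x :> G f x)"

text \<open>\<open>A t (\<xi>, h)\<close> is the \<open>t\<close>-th query (\<open>t \<ge> 1\<close>), where \<open>h i\<close> for \<open>1 \<le> i < t\<close> is the oracle's answer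
  to the \<open>i\<close>-th query.\<close>

type_synonym 'a algorithm = "nat \<Rightarrow> real \<times> (nat \<Rightarrow> real \<times> 'a) \<Rightarrow> 'a"

definition randomized_first_order :: "'a::topological_space algorithm \<Rightarrow> bool" where
  "randomized_first_order A \<longleftrightarrow>
     (\<forall>t\<ge>1. A t \<in> borel \<Otimes>\<^sub>M (\<Pi>\<^sub>M i\<in>{1..<t}. (borel \<Otimes>\<^sub>M borel)) \<rightarrow>\<^sub>M borel)"

lemma restrict_fundef_cong [fundef_cong]:
  "I = J \<Longrightarrow> (\<And>i. i \<in> J \<Longrightarrow> f i = g i) \<Longrightarrow> restrict f I = restrict g J"
  by (auto simp: restrict_def)

function iterate :: "'a algorithm \<Rightarrow> real \<Rightarrow> ('a \<Rightarrow> real) \<Rightarrow> ('a \<Rightarrow> 'a) \<Rightarrow> nat \<Rightarrow> 'a" where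
  "iterate A \<xi> f g t = A t (\<xi>, \<lambda>i\<in>{1..<t}. (f (iterate A \<xi> f g i), g (iterate A \<xi> f g i)))"
  by pat_completeness auto
termination
  by (relation "Wellfounded.measure (\<lambda>(A, \<xi>, f, g, t). t)") auto

declare iterate.simps [simp del]

definition alg_output :: "'a algorithm \<Rightarrow> real \<Rightarrow> ('a \<Rightarrow> real) \<Rightarrow> ('a \<Rightarrow> 'a) \<Rightarrow> nat \<Rightarrow> 'a" where
  "alg_output A \<xi> f g n = iterate A \<xi> f g (n + 1)"

text \<open>A set of functions carries the \<open>\<sigma>\<close>-algebra generated by the evaluations \<open>f \<mapsto> f x\<close>.\<close>

definition fun_space :: "('a \<Rightarrow> real) set \<Rightarrow> ('a \<Rightarrow> real) measure" where
  "fun_space \<F> = restrict_space (\<Pi>\<^sub>M x\<in>UNIV. borel) \<F>"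

definition prob_measure_on :: "('a \<Rightarrow> real) set \<Rightarrow> ('a \<Rightarrow> real) measure \<Rightarrow> bool" where
  "prob_measure_on \<F> D \<longleftrightarrow> prob_space D \<and> sets D = sets (fun_space \<F>)"

definition seed_and_function :: "('a \<Rightarrow> real) measure \<Rightarrow> (real \<times> ('a \<Rightarrow> real)) measure" where
  "seed_and_function D = uniform_measure lborel {0..1} \<Otimes>\<^sub>M D"

text \<open>For a non-measurable selection of subgradients \<open>G\<close> this set need not be measurable for the product
  measure, so its probability is then taken in the \<^const>\<open>completion\<close>. On measurable sets the two agree.\<close>

definition slow_event ::
    "(nat \<Rightarrow> real) \<Rightarrow> (real \<Rightarrow> real) \<Rightarrow> 'a algorithm \<Rightarrow> (('a \<Rightarrow> real) \<Rightarrow> 'a \<Rightarrow> 'a)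
      \<Rightarrow> ('a \<Rightarrow> real) measure \<Rightarrow> (real \<times> ('a \<Rightarrow> real)) set" where
  "slow_event r \<rho> A G D =
     {(\<xi>, F) \<in> space (seed_and_function D).
        limsup (\<lambda>n. ereal (r n * (F (alg_output A \<xi> F (G F) n) - inf_val F) / \<rho> (real n))) \<ge> 1}"

end

theory Submission
  imports Defs
begin

text \<open>The random objective is \<open>F x = (\<Sum>k. a k * f k x)\<close>. The piece \<open>f k\<close> is hard for \<open>N k\<close> queries, where
  \<open>N k\<close> is so large that \<open>\<rho> (N k)\<close> is negligible compared with the weight of the piece. It is a
  smoothed maximum of \<open>N k + 1\<close> affine functions of the coordinates along basis vectors
  \<open>e (k, i, \<omega> (k, i))\<close>, whose labels \<open>\<omega> (k, i)\<close> are independent and uniform on a huge finite set. Because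
  the affine functions have decreasing offsets and the smoothing is local, a query that is not
  correlated with the unknown directions reveals at most the next one. By Bessel's inequality a
  bounded query is correlated with few basis vectors, so the last direction is unknown after \<open>N k\<close>
  queries except with probability \<open>2 ^ -k\<close>. By Borel--Cantelli this holds for all large \<open>k\<close>, almost
  surely, so the slow event even has probability \<open>1\<close>. The smoothing makes each piece \<open>1 / \<mu>\<close>-smooth
  with \<open>\<mu>\<close> of order \<open>N powr (- 3/2)\<close>, which yields \<open>1 / sqrt N\<close> for Lipschitz weights and
  \<open>1 / N\<^sup>2\<close> for smooth ones. All objectives are differentiable, so that the selection of
  subgradients cannot leak information.\<close>

subsection \<open>Smoothed maximum over the simplex\<close>

text \<open>One fixed law has to defeat every algorithm, queries may lie anywhere, and no answer can
  be adapted to the algorithm. Hence the labels: as long as nothing is revealed, all but a bounded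
  number of candidates for a direction are nearly orthogonal to a query, and infinite dimension
  offers as many candidates as desired. All pieces must be slow within a single function. They use
  disjoint blocks of basis vectors, so one point minimizes all of them; the gap of \<open>F\<close>
  is then a sum of nonnegative gaps and inherits that of each piece. Block \<open>k\<close> of this
  point has norm \<open>(1/2) ^ (k + 1)\<close>, which keeps the point in the unit ball and costs a
  factor exponential in \<open>k\<close>. A limsup asks only for a sparse set of indices and \<rho>
  is given in advance, so \<open>N k\<close> can be picked large enough to outweigh such factors.
  Measurability is a second obstacle. An arbitrary selection of subgradients is controlled only
  where subgradients are unique, so the event is studied on a measurable set of such functions that
  has full measure.\<close>

text \<open>By duality \<open>smax \<mu> I h\<close> is the maximum of \<open>(\<Sum>i\<in>I. p i * h i) - \<mu> / 2 * (\<Sum>i\<in>I. (p i)\<^sup>2)\<close> over the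
  probability vectors \<open>p\<close>, and \<open>smax_weight\<close> is the maximizer. Unlike the logarithm of a sum of
  exponentials, this smoothing ignores entries that lie \<open>\<mu>\<close> below the maximum.\<close>

definition smax_level :: "real \<Rightarrow> 'i set \<Rightarrow> ('i \<Rightarrow> real) \<Rightarrow> real" where
  "smax_level \<mu> I h = (SOME \<tau>. (\<Sum>i\<in>I. max 0 (h i - \<tau>)) = \<mu>)"

definition smax_weight :: "real \<Rightarrow> 'i set \<Rightarrow> ('i \<Rightarrow> real) \<Rightarrow> 'i \<Rightarrow> real" where
  "smax_weight \<mu> I h i = max 0 (h i - smax_level \<mu> I h) / \<mu>"

definition smax :: "real \<Rightarrow> 'i set \<Rightarrow> ('i \<Rightarrow> real) \<Rightarrow> real" where
  "smax \<mu> I h = smax_level \<mu> I h + (\<Sum>i\<in>I. (max 0 (h i - smax_level \<mu> I h))\<^sup>2) / (2 * \<mu>)"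

text \<open>The total excess over \<tau> is continuous in \<tau>, vanishes at the maximum of
  \<open>h\<close> and is at least \<mu> when \<tau> lies \<mu> below that maximum.\<close>

lemma smax_level:
  assumes "finite I" "I \<noteq> {}" "\<mu> > 0"
  shows "(\<Sum>i\<in>I. max 0 (h i - smax_level \<mu> I h)) = \<mu>"
proof -
  define \<phi> where "\<phi> \<tau> = (\<Sum>i\<in>I. max 0 (h i - \<tau>))" for \<tau>
  define M where "M = Max (h ` I)"
  have M: "h i \<le> M" if "i \<in> I" for i using that assms by (simp add: M_def)
  have "M \<in> h ` I" using assms unfolding M_def by (intro Max_in) auto
  then obtain m where m: "m \<in> I" "h m = M" by auto
  have "\<phi> M = 0" using M by (auto simp: \<phi>_def intro!: sum.neutral)
  moreover have "\<phi> (M - \<mu>) \<ge> \<mu>"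
  proof -
    have "max 0 (h m - (M - \<mu>)) \<le> \<phi> (M - \<mu>)"
      unfolding \<phi>_def using assms m(1) by (intro member_le_sum) auto
    then show ?thesis using m by simp
  qed
  moreover have "continuous_on {M - \<mu>..M} \<phi>" unfolding \<phi>_def by (intro continuous_intros)
  ultimately obtain \<tau> where "\<phi> \<tau> = \<mu>"
    using IVT2'[of \<phi> M \<mu> "M - \<mu>"] assms(3) by auto
  then show ?thesis unfolding smax_level_def \<phi>_def by (rule someI)
qed

text \<open>The total excess strictly decreases while some entry exceeds the threshold, which
  \<open>\<mu> > 0\<close> enforces. In \<open>smax_local\<close> this identifies the levels of two
  vectors that agree on \<open>K\<close>.\<close>

lemma smax_level_unique:
  assumes "finite I" "\<mu> > 0"
    and "(\<Sum>i\<in>I. max 0 (h i - s)) = \<mu>" "(\<Sum>i\<in>I. max 0 (h i - t)) = (\<mu>::real)"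
  shows "s = t"
proof -
  have *: "\<not> s < t" if s: "(\<Sum>i\<in>I. max 0 (h i - s)) = \<mu>" and t: "(\<Sum>i\<in>I. max 0 (h i - t)) = \<mu>" for s t
  proof
    assume "s < t"
    have "\<exists>i\<in>I. h i > t"
    proof (rule ccontr)
      assume "\<not> (\<exists>i\<in>I. h i > t)"
      then have "(\<Sum>i\<in>I. max 0 (h i - t)) = 0" by (intro sum.neutral) force
      then show False using t assms by simp
    qed
    then obtain i where "i \<in> I" "h i > t" by auto
    then have "(\<Sum>i\<in>I. max 0 (h i - t)) < (\<Sum>i\<in>I. max 0 (h i - s))"
      using \<open>s < t\<close> assms(1) by (intro sum_strict_mono_ex1) (auto intro!: bexI[of _ i])
    then show False using s t by simp
  qed
  show ?thesis using *[OF assms(3,4)] *[OF assms(4,3)] by simp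
qed

lemma smax_weight_nonneg: "\<mu> > 0 \<Longrightarrow> smax_weight \<mu> I h i \<ge> 0"
  by (simp add: smax_weight_def)

lemma sum_smax_weight:
  assumes "finite I" "I \<noteq> {}" "\<mu> > 0"
  shows "(\<Sum>i\<in>I. smax_weight \<mu> I h i) = 1"
  using smax_level[OF assms, of h] assms(3)
  by (simp add: smax_weight_def flip: sum_divide_distrib)

text \<open>Where a weight is positive, \<open>h i\<close> equals the level plus \<mu> times the
  weight; summing this against the weights gives strong duality.\<close>

lemma smax_eq:
  assumes "finite I" "I \<noteq> {}" "\<mu> > 0"
  shows "smax \<mu> I h = (\<Sum>i\<in>I. smax_weight \<mu> I h i * h i) - \<mu> / 2 * (\<Sum>i\<in>I. (smax_weight \<mu> I h i)\<^sup>2)"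
proof -
  define w where "w = smax_weight \<mu> I h"
  define \<tau> where "\<tau> = smax_level \<mu> I h"
  have *: "w i * h i = w i * \<tau> + \<mu> * (w i)\<^sup>2" for i
    using assms(3) by (auto simp: w_def smax_weight_def \<tau>_def max_def field_simps power2_eq_square)
  have "(\<Sum>i\<in>I. w i * h i) = \<tau> + \<mu> * (\<Sum>i\<in>I. (w i)\<^sup>2)"
  proof -
    have "(\<Sum>i\<in>I. w i * h i) = (\<Sum>i\<in>I. w i) * \<tau> + \<mu> * (\<Sum>i\<in>I. (w i)\<^sup>2)"
      by (simp add: * sum.distrib sum_distrib_left sum_distrib_right)
    then show ?thesis using sum_smax_weight[OF assms, of h] by (simp add: w_def)
  qed
  moreover have "(\<Sum>i\<in>I. (max 0 (h i - \<tau>))\<^sup>2) / (2 * \<mu>) = \<mu> / 2 * (\<Sum>i\<in>I. (w i)\<^sup>2)"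
    using assms(3) by (simp add: w_def smax_weight_def \<tau>_def sum_divide_distrib sum_distrib_left power2_eq_square)
  ultimately show ?thesis unfolding smax_def w_def[symmetric] \<tau>_def[symmetric] by simp
qed



text \<open>Weak duality, from Young's inequality between \<open>p i\<close> and the excess over
  \<tau>. Here \<tau> is arbitrary, because \<open>smax_upper\<close> evaluates the bound for one
  vector at the level of another.\<close>

lemma simplex_le_level:
  fixes p h :: "'i \<Rightarrow> real"
  assumes "finite I" "\<mu> > 0" "\<And>i. i \<in> I \<Longrightarrow> p i \<ge> 0" "sum p I = 1"
  shows "(\<Sum>i\<in>I. p i * h i) - \<mu> / 2 * (\<Sum>i\<in>I. (p i)\<^sup>2) \<le> \<tau> + (\<Sum>i\<in>I. (max 0 (h i - \<tau>))\<^sup>2) / (2 * \<mu>)"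
proof -
  have *: "p i * h i - \<mu> / 2 * (p i)\<^sup>2 \<le> p i * \<tau> + (max 0 (h i - \<tau>))\<^sup>2 / (2 * \<mu>)" if "i \<in> I" for i
  proof -
    define u where "u = max 0 (h i - \<tau>)"
    have "p i * (h i - \<tau>) \<le> p i * u" using assms(3)[OF that] by (intro mult_left_mono) (auto simp: u_def)
    moreover have "0 \<le> (u - \<mu> * p i)\<^sup>2 / (2 * \<mu>)" using assms(2) by simp
    then have "p i * u \<le> u\<^sup>2 / (2 * \<mu>) + \<mu> / 2 * (p i)\<^sup>2"
      using assms(2) by (simp add: field_simps power2_eq_square)
    ultimately show ?thesis unfolding u_def by (simp add: algebra_simps)
  qed
  have "(\<Sum>i\<in>I. p i * h i - \<mu> / 2 * (p i)\<^sup>2) \<le> (\<Sum>i\<in>I. p i * \<tau> + (max 0 (h i - \<tau>))\<^sup>2 / (2 * \<mu>))"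
    by (rule sum_mono) (rule *)
  moreover have "(\<Sum>i\<in>I. p i * \<tau>) = \<tau>" using assms(4) by (simp flip: sum_distrib_right)
  ultimately show ?thesis
    by (simp only: sum.distrib sum_subtractf sum_divide_distrib sum_distrib_left)
qed

lemma smax_ge_simplex:
  assumes "finite I" "\<mu> > 0" "\<And>i. i \<in> I \<Longrightarrow> p i \<ge> 0" "sum p I = 1"
  shows "(\<Sum>i\<in>I. p i * h i) - \<mu> / 2 * (\<Sum>i\<in>I. (p i)\<^sup>2) \<le> smax \<mu> I h"
  unfolding smax_def using assms by (rule simplex_le_level)

lemma smax_ge:
  assumes "finite I" "\<mu> > 0" "m \<in> I"
  shows "h m - \<mu> / 2 \<le> smax \<mu> I h"
proof -
  have "I \<inter> {i. i = m} = {m}" using assms(3) by auto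
  then have "(\<Sum>i\<in>I. of_bool (i = m) * h i) = h m" "(\<Sum>i\<in>I. (of_bool (i = m) :: real)) = 1"
    "(\<Sum>i\<in>I. (of_bool (i = m) :: real)\<^sup>2) = 1"
    using assms(1) by (simp_all add: power2_eq_square flip: of_bool_conj)
  then show ?thesis
    using smax_ge_simplex[OF assms(1,2), of "\<lambda>i. of_bool (i = m)" h] by simp
qed

lemma smax_le:
  assumes "finite I" "I \<noteq> {}" "\<mu> > 0" "\<And>i. i \<in> I \<Longrightarrow> h i \<le> c"
  shows "smax \<mu> I h \<le> c"
proof -
  have "(\<Sum>i\<in>I. smax_weight \<mu> I h i * h i) \<le> (\<Sum>i\<in>I. smax_weight \<mu> I h i * c)"
    using assms by (intro sum_mono mult_left_mono smax_weight_nonneg) auto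
  also have "\<dots> = c" using sum_smax_weight[OF assms(1-3), of h] by (simp flip: sum_distrib_right)
  finally show ?thesis using assms(3) unfolding smax_eq[OF assms(1-3)]
    by (smt (verit, best) divide_nonneg_nonneg mult_nonneg_nonneg sum_nonneg zero_le_power2)
qed

text \<open>The maximizing weights at \<open>h\<close> remain admissible for \<open>h'\<close>, and
  for fixed weights the dual objective is affine in the entries.\<close>

lemma smax_lower:
  assumes "finite I" "I \<noteq> {}" "\<mu> > 0"
  shows "smax \<mu> I h + (\<Sum>i\<in>I. smax_weight \<mu> I h i * (h' i - h i)) \<le> smax \<mu> I h'"
proof -
  have "(\<Sum>i\<in>I. smax_weight \<mu> I h i * h' i) - \<mu> / 2 * (\<Sum>i\<in>I. (smax_weight \<mu> I h i)\<^sup>2) \<le> smax \<mu> I h'"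
    using assms by (intro smax_ge_simplex sum_smax_weight smax_weight_nonneg) auto
  then show ?thesis unfolding smax_eq[OF assms, of h] by (simp add: right_diff_distrib sum_subtractf)
qed

text \<open>Bounding the value at \<open>h'\<close> by the dual expression at the level of
  \<open>h\<close> avoids any study of how the level moves.\<close>

lemma smax_upper:
  assumes "finite I" "I \<noteq> {}" "\<mu> > 0"
  shows "smax \<mu> I h' \<le> smax \<mu> I h + (\<Sum>i\<in>I. smax_weight \<mu> I h i * (h' i - h i))
            + (\<Sum>i\<in>I. (h' i - h i)\<^sup>2) / (2 * \<mu>)"
proof -
  define \<tau> where "\<tau> = smax_level \<mu> I h"
  have *: "(max 0 (h' i - \<tau>))\<^sup>2 / (2 * \<mu>)
      \<le> (max 0 (h i - \<tau>))\<^sup>2 / (2 * \<mu>) + smax_weight \<mu> I h i * (h' i - h i) + (h' i - h i)\<^sup>2 / (2 * \<mu>)" for i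
  proof -
    define u where "u = max 0 (h i - \<tau>)"
    \<comment> \<open>Below the level the old excess \<open>u\<close> is zero, so the linear term
      vanishes and the new excess is at most the size of the increment.\<close>
    have "(max 0 (h' i - \<tau>))\<^sup>2 \<le> (u + (h' i - h i))\<^sup>2 \<or> (max 0 (h' i - \<tau>))\<^sup>2 \<le> (h' i - h i)\<^sup>2 \<and> u = 0"
      by (cases "h i \<ge> \<tau>"; cases "h' i \<ge> \<tau>") (auto simp: u_def max_def intro!: power_mono)
    then have "(max 0 (h' i - \<tau>))\<^sup>2 \<le> u\<^sup>2 + 2 * u * (h' i - h i) + (h' i - h i)\<^sup>2"
      by (auto simp: power2_sum)
    then have "(max 0 (h' i - \<tau>))\<^sup>2 / (2 * \<mu>) \<le> (u\<^sup>2 + 2 * u * (h' i - h i) + (h' i - h i)\<^sup>2) / (2 * \<mu>)"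
      using assms(3) by (intro divide_right_mono) auto
    then show ?thesis using assms(3) by (simp add: smax_weight_def u_def[symmetric] \<tau>_def[symmetric] add_divide_distrib)
  qed
  have "smax \<mu> I h' \<le> \<tau> + (\<Sum>i\<in>I. (max 0 (h' i - \<tau>))\<^sup>2) / (2 * \<mu>)"
    unfolding smax_eq[OF assms]
    using assms by (intro simplex_le_level sum_smax_weight smax_weight_nonneg) auto
  also have "\<dots> \<le> \<tau> + (\<Sum>i\<in>I. (max 0 (h i - \<tau>))\<^sup>2 / (2 * \<mu>) + smax_weight \<mu> I h i * (h' i - h i) + (h' i - h i)\<^sup>2 / (2 * \<mu>))"
    unfolding sum_divide_distrib by (intro add_left_mono sum_mono *)
  also have "\<dots> = smax \<mu> I h + (\<Sum>i\<in>I. smax_weight \<mu> I h i * (h' i - h i)) + (\<Sum>i\<in>I. (h' i - h i)\<^sup>2) / (2 * \<mu>)"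
    by (simp add: smax_def \<tau>_def sum.distrib sum_divide_distrib)
  finally show ?thesis .
qed



text \<open>No single excess can exceed the total \<mu>, so the level is at least
  \<open>h m - \<mu>\<close>. Entries outside \<open>K\<close> then have no excess, and both levels
  solve the same equation over \<open>K\<close>.\<close>

lemma smax_local:
  assumes "finite I" "\<mu> > 0" "m \<in> K" "K \<subseteq> I"
    and eq: "\<And>i. i \<in> K \<Longrightarrow> h i = h' i"
    and low: "\<And>i. i \<in> I - K \<Longrightarrow> h i \<le> h m - \<mu>" "\<And>i. i \<in> I - K \<Longrightarrow> h' i \<le> h m - \<mu>"
  shows "smax \<mu> I h = smax \<mu> I h'"
    and "\<And>i. i \<in> K \<Longrightarrow> smax_weight \<mu> I h i = smax_weight \<mu> I h' i"
    and "\<And>i. i \<in> I - K \<Longrightarrow> smax_weight \<mu> I h i = 0"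
proof -
  have "finite K" using assms finite_subset by blast
  have level: "h m - \<mu> \<le> smax_level \<mu> I g" if "g m = h m" for g
  proof -
    have "max 0 (g m - smax_level \<mu> I g) \<le> (\<Sum>i\<in>I. max 0 (g i - smax_level \<mu> I g))"
      using assms by (intro member_le_sum) auto
    also have "\<dots> = \<mu>" using assms by (intro smax_level) auto
    finally show ?thesis using that by simp
  qed
  define s where "s = smax_level \<mu> I h"
  define t where "t = smax_level \<mu> I h'"
  have st: "h m - \<mu> \<le> s" "h m - \<mu> \<le> t" using level[of h] level[of h'] eq assms by (auto simp: s_def t_def)
  have 1: "max 0 (h i - s) = 0" "max 0 (h' i - t) = 0" if "i \<in> I - K" for i
    using low[OF that] st by auto
  have "(\<Sum>i\<in>K. max 0 (h i - s)) = (\<Sum>i\<in>I. max 0 (h i - s))"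
    using assms 1 by (intro sum.mono_neutral_left) auto
  moreover have "\<dots> = \<mu>" using assms unfolding s_def by (intro smax_level) auto
  moreover have "(\<Sum>i\<in>K. max 0 (h i - t)) = (\<Sum>i\<in>I. max 0 (h' i - t))"
    using assms 1 by (intro sum.mono_neutral_cong_left) auto
  moreover have "\<dots> = \<mu>" using assms unfolding t_def by (intro smax_level) auto
  ultimately have "s = t" using smax_level_unique[OF \<open>finite K\<close> assms(2)] by metis
  have 2: "max 0 (h i - s) = max 0 (h' i - t)" if "i \<in> I" for i
    using 1[of i] eq[of i] that \<open>s = t\<close> by (cases "i \<in> K") auto
  show "smax \<mu> I h = smax \<mu> I h'"
    unfolding smax_def using 2 \<open>s = t\<close> by (simp add: s_def[symmetric] t_def[symmetric])
  show "\<And>i. i \<in> K \<Longrightarrow> smax_weight \<mu> I h i = smax_weight \<mu> I h' i"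
    unfolding smax_weight_def s_def[symmetric] t_def[symmetric] using 2 assms(4) by (simp add: subset_iff)
  show "\<And>i. i \<in> I - K \<Longrightarrow> smax_weight \<mu> I h i = 0"
    unfolding smax_weight_def using 1 by (auto simp: s_def[symmetric])
qed

section \<open>Convex functions with first-order bounds\<close>

text \<open>Convexity and the quadratic upper bound of L-smoothness in one condition, which passes
  term by term to infinite weighted sums; the derivative and its Lipschitz constant are derived only
  afterwards.\<close>

definition sandwiched :: "real \<Rightarrow> ('a::real_inner \<Rightarrow> real) \<Rightarrow> ('a \<Rightarrow> 'a) \<Rightarrow> bool" where
  "sandwiched L f g \<longleftrightarrow> (\<forall>x d. f x + g x \<bullet> d \<le> f (x + d) \<and> f (x + d) \<le> f x + g x \<bullet> d + L / 2 * (norm d)\<^sup>2)"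

lemma sandwiched_GDERIV:
  assumes "sandwiched L f g" "L \<ge> 0"
  shows "GDERIV f x :> g x"
  unfolding gderiv_def has_derivative_at
proof (intro conjI bounded_linear_intros)
  have bound: "norm (f (x + h) - f x - h \<bullet> g x) / norm h \<le> L / 2 * norm h" for h
  proof (cases "h = 0")
    case False
    have "norm (f (x + h) - f x - h \<bullet> g x) \<le> L / 2 * norm h * norm h"
      using assms(1)[unfolded sandwiched_def, rule_format, of x h]
      by (simp add: inner_commute[of h "g x"] power2_eq_square abs_le_iff)
    then show ?thesis using False by (simp add: divide_le_eq)
  qed simp
  show "(\<lambda>h. norm (f (x + h) - f x - h \<bullet> g x) / norm h) \<midarrow>0\<rightarrow> 0"
  proof (rule Lim_null_comparison)
    show "\<forall>\<^sub>F h in at 0. norm (norm (f (x + h) - f x - h \<bullet> g x) / norm h) \<le> L / 2 * norm h"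
      using bound by (intro always_eventually allI) (simp only: norm_divide real_norm_def abs_norm_cancel abs_divide abs_abs)
    show "((\<lambda>h::'a. L / 2 * norm h) \<longlongrightarrow> 0) (at 0)"
      by (intro tendsto_mult_right_zero tendsto_norm_zero tendsto_ident_at)
  qed
qed

text \<open>Minimizing the upper bound at \<open>y\<close> of the function \<open>f - g x\<close>, which is minimal at \<open>x\<close>, gives
  cocoercivity of \<open>g\<close>.\<close>

lemma sandwiched_lipschitz:
  assumes "sandwiched L f g" "L > 0"
  shows "L-lipschitz_on UNIV g"
proof (rule lipschitz_onI)
  fix x y
  have co: "f x + g x \<bullet> (y - x) + (norm (g y - g x))\<^sup>2 / (2 * L) \<le> f y" for x y
  proof -
    define w where "w = (1 / L) *\<^sub>R (g x - g y)"
    have "f x + g x \<bullet> (y + w - x) \<le> f (y + w)"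
      using assms(1)[unfolded sandwiched_def, rule_format, of x "y + w - x"] by simp
    also have "\<dots> \<le> f y + g y \<bullet> w + L / 2 * (norm w)\<^sup>2"
      using assms(1)[unfolded sandwiched_def, rule_format, of y w] by simp
    finally have "f x + g x \<bullet> (y - x) + (g x - g y) \<bullet> w - L / 2 * (norm w)\<^sup>2 \<le> f y"
      by (simp add: algebra_simps)
    moreover have "(g x - g y) \<bullet> w = (norm (g y - g x))\<^sup>2 / L"
      by (simp add: w_def power2_norm_eq_inner norm_minus_commute)
    moreover have "L / 2 * (norm w)\<^sup>2 = (norm (g y - g x))\<^sup>2 / (2 * L)"
    proof -
      have "norm w = norm (g y - g x) / L" using assms(2) by (simp add: w_def norm_minus_commute)
      show ?thesis unfolding \<open>norm w = _\<close> using assms(2) by (simp add: power2_eq_square)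
    qed
    moreover have "(norm (g y - g x))\<^sup>2 / L = 2 * ((norm (g y - g x))\<^sup>2 / (2 * L))" by simp
    ultimately show ?thesis by linarith
  qed
  have "(norm (g y - g x))\<^sup>2 / L \<le> (g y - g x) \<bullet> (y - x)"
    using co[of x y] co[of y x] by (simp add: norm_minus_commute algebra_simps)
  also have "\<dots> \<le> norm (g y - g x) * norm (y - x)" by (rule norm_cauchy_schwarz)
  finally have "norm (g y - g x) * norm (g y - g x) \<le> norm (g y - g x) * (L * norm (y - x))"
    using assms(2) by (simp add: field_simps power2_eq_square)
  then have "norm (g y - g x) \<le> L * norm (y - x)" using assms(2)
    by (cases "g y = g x") (auto intro: mult_left_le_imp_le)
  then show "dist (g x) (g y) \<le> L * dist x y" by (simp add: dist_norm norm_minus_commute)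
qed (use assms in simp)

lemma convex_on_if_subgradients:
  fixes f :: "'a::real_inner \<Rightarrow> real"
  assumes "\<And>x d. f x + g x \<bullet> d \<le> f (x + d)"
  shows "convex_on UNIV f"
proof (rule convex_onI)
  fix t :: real and x y :: 'a assume t: "0 < t" "t < 1"
  define z where "z = (1 - t) *\<^sub>R x + t *\<^sub>R y"
  have "(1 - t) * (f z + g z \<bullet> (x - z)) \<le> (1 - t) * f x" "t * (f z + g z \<bullet> (y - z)) \<le> t * f y"
    using assms[of z "x - z"] assms[of z "y - z"] t by (auto intro!: mult_left_mono)
  moreover have "(1 - t) * (f z + g z \<bullet> (x - z)) + t * (f z + g z \<bullet> (y - z))
      = f z + g z \<bullet> ((1 - t) *\<^sub>R x + t *\<^sub>R y - z)"
    by (simp add: inner_add_right inner_diff_right algebra_simps)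
  ultimately have "f z \<le> (1 - t) * f x + t * f y" by (simp add: z_def)
  then show "f ((1 - t) *\<^sub>R x + t *\<^sub>R y) \<le> (1 - t) * f x + t * f y" by (simp add: z_def)
qed auto

lemma lipschitz_if_bounded_subgradients:
  fixes f :: "'a::real_inner \<Rightarrow> real"
  assumes "\<And>x d. f x + g x \<bullet> d \<le> f (x + d)" "\<And>x. norm (g x) \<le> C"
  shows "\<bar>f y - f x\<bar> \<le> C * norm (y - x)"
proof -
  have *: "f x - f y \<le> C * norm (y - x)" for x y
  proof -
    have "f x - f y \<le> g x \<bullet> (x - y)" using assms(1)[of x "y - x"] by (simp add: inner_diff_right)
    also have "\<dots> \<le> norm (g x) * norm (x - y)" by (rule norm_cauchy_schwarz)
    also have "\<dots> \<le> C * norm (x - y)" using assms(2) by (intro mult_right_mono) auto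
    finally show ?thesis by (simp add: norm_minus_commute)
  qed
  show ?thesis using *[of x y] *[of y x] by (simp add: norm_minus_commute)
qed

section \<open>Orthonormal families and Bessel's inequality\<close>

definition orthonormal :: "('i \<Rightarrow> 'a::real_inner) \<Rightarrow> bool" where
  "orthonormal e \<longleftrightarrow> (\<forall>i j. e i \<bullet> e j = of_bool (i = j))"

lemma orthonormal_expansion_norm:
  assumes "orthonormal e" "finite I"
  shows "(norm (\<Sum>i\<in>I. c i *\<^sub>R e i))\<^sup>2 = (\<Sum>i\<in>I. (c i)\<^sup>2)"
proof -
  have "c i * (\<Sum>j\<in>I. c j * (e j \<bullet> e i)) = (c i)\<^sup>2" if "i \<in> I" for i
  proof -
    have "(\<Sum>j\<in>I. c j * (e j \<bullet> e i)) = (\<Sum>j\<in>I. if i = j then c j else 0)"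
      using assms(1) by (intro sum.cong) (auto simp: orthonormal_def)
    then show ?thesis using that assms(2) by (simp add: power2_eq_square)
  qed
  then show ?thesis
    unfolding power2_norm_eq_inner by (simp add: inner_sum_left inner_sum_right)
qed

lemma bessel:
  assumes "orthonormal e" "finite I"
  shows "(\<Sum>i\<in>I. (e i \<bullet> x)\<^sup>2) \<le> (norm x)\<^sup>2"
proof -
  define y where "y = (\<Sum>i\<in>I. (e i \<bullet> x) *\<^sub>R e i)"
  have "(norm y)\<^sup>2 = (\<Sum>i\<in>I. (e i \<bullet> x)\<^sup>2)" unfolding y_def by (rule orthonormal_expansion_norm[OF assms])
  moreover have "y \<bullet> x = (\<Sum>i\<in>I. (e i \<bullet> x)\<^sup>2)"
    by (simp add: y_def inner_sum_left power2_eq_square)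
  moreover have "0 \<le> (norm (x - y))\<^sup>2" by simp
  then have "0 \<le> (norm x)\<^sup>2 - 2 * (y \<bullet> x) + (norm y)\<^sup>2"
    by (simp add: power2_norm_eq_inner algebra_simps inner_commute)
  ultimately show ?thesis by simp
qed

text \<open>Each counted coefficient contributes more than \<open>\<gamma>\<^sup>2\<close> to
  Bessel's sum. The bound does not grow with \<open>I\<close>, so a query hits only a small share of
  a large set of candidates.\<close>

lemma card_large_coefficients:
  assumes "orthonormal e" "finite I" "\<gamma> > 0" "norm x \<le> R"
  shows "card {i \<in> I. \<gamma> < \<bar>e i \<bullet> x\<bar>} \<le> R\<^sup>2 / \<gamma>\<^sup>2"
proof -
  let ?J = "{i \<in> I. \<gamma> < \<bar>e i \<bullet> x\<bar>}"
  have "card ?J * \<gamma>\<^sup>2 = (\<Sum>i\<in>?J. \<gamma>\<^sup>2)" by simp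
  also have "\<dots> \<le> (\<Sum>i\<in>?J. (e i \<bullet> x)\<^sup>2)"
    using assms(3) by (intro sum_mono) (auto simp flip: abs_le_square_iff)
  also have "\<dots> \<le> (norm x)\<^sup>2" using assms by (intro bessel) auto
  also have "\<dots> \<le> R\<^sup>2" using assms by (intro power_mono) auto
  finally show ?thesis using assms(3) by (simp add: field_simps)
qed

text \<open>Gram--Schmidt: finitely many vectors never span, so some vector has a nonzero residual
  after projection. The recursion carries the list of all earlier vectors, as each new one must be
  orthogonal to all of them.\<close>

lemma exists_orthonormal_sequence:
  assumes "\<nexists>B :: 'a::real_inner set. finite B \<and> span B = UNIV"
  shows "\<exists>e :: nat \<Rightarrow> 'a. orthonormal e"
proof -
  have step: "\<exists>v. norm v = 1 \<and> (\<forall>u\<in>set us. v \<bullet> u = 0)"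
    if us: "\<forall>u\<in>set us. \<forall>w\<in>set us. u \<bullet> w = of_bool (u = w)" for us :: "'a list"
  proof -
    obtain x where x: "x \<notin> span (set us)" using assms by blast
    define y where "y = x - (\<Sum>u\<in>set us. (x \<bullet> u) *\<^sub>R u)"
    have "(\<Sum>u\<in>set us. (x \<bullet> u) *\<^sub>R u) \<in> span (set us)"
      by (intro span_sum span_scale span_base)
    then have "y \<noteq> 0" using x by (auto simp: y_def)
    moreover have "y \<bullet> u = 0" if "u \<in> set us" for u
    proof -
      have "(\<Sum>w\<in>set us. (x \<bullet> w) * (w \<bullet> u)) = (\<Sum>w\<in>set us. if u = w then x \<bullet> w else 0)"
        using that us by (intro sum.cong) (auto simp: of_bool_def)
      then show ?thesis using that by (simp add: y_def inner_diff_left inner_sum_left)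
    qed
    ultimately show ?thesis by (intro exI[of _ "(1 / norm y) *\<^sub>R y"]) auto
  qed
  define nxt :: "'a list \<Rightarrow> 'a" where "nxt us = (SOME v. norm v = 1 \<and> (\<forall>u\<in>set us. v \<bullet> u = 0))" for us
  define L where "L n = rec_nat [] (\<lambda>_ us. nxt us # us) n" for n
  have L: "L 0 = []" "L (Suc n) = nxt (L n) # L n" for n by (simp_all add: L_def)
  have inv: "\<forall>u\<in>set (L n). \<forall>w\<in>set (L n). u \<bullet> w = of_bool (u = w)" for n
  proof (induction n)
    case (Suc n)
    have "norm (nxt (L n)) = 1 \<and> (\<forall>u\<in>set (L n). nxt (L n) \<bullet> u = 0)"
      unfolding nxt_def using step[OF Suc] by (rule someI_ex)
    then have "nxt (L n) \<bullet> nxt (L n) = 1" "\<forall>u\<in>set (L n). nxt (L n) \<bullet> u = 0"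
      by (auto simp flip: power2_norm_eq_inner)
    with Suc show ?case by (auto simp: L inner_commute)
  qed (simp add: L)
  have nxt: "norm (nxt (L n)) = 1" "\<And>u. u \<in> set (L n) \<Longrightarrow> nxt (L n) \<bullet> u = 0" for n
    using someI_ex[OF step[OF inv[of n]]] unfolding nxt_def by auto
  have sub: "nxt (L m) \<in> set (L n)" if "m < n" for m n
    using that by (induction n) (auto simp: L less_Suc_eq)
  have "nxt (L i) \<bullet> nxt (L j) = of_bool (i = j)" for i j
  proof (cases i j rule: linorder_cases)
    case less then show ?thesis using nxt(2)[OF sub[OF less]] by (simp add: inner_commute)
  next
    case equal then show ?thesis using nxt(1)[of i] by (simp flip: power2_norm_eq_inner)
  next
    case greater then show ?thesis using nxt(2)[OF sub[OF greater]] by simp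
  qed
  then show ?thesis unfolding orthonormal_def by (intro exI[of _ "\<lambda>n. nxt (L n)"]) blast
qed

subsection \<open>Measurability of first-order algorithms\<close>

text \<open>Measurability is given at fixed arguments only. Approximating \<open>x\<close> by simple
  functions reduces to finitely many of those, and continuity passes to the limit.\<close>

lemma measurable_eval_continuous:
  fixes x :: "'m \<Rightarrow> 'a::{metric_space, second_countable_topology}" and f :: "'m \<Rightarrow> 'a \<Rightarrow> real"
  assumes f: "\<And>y. (\<lambda>\<omega>. f \<omega> y) \<in> borel_measurable M"
    and cont: "\<And>\<omega>. \<omega> \<in> space M \<Longrightarrow> continuous_on UNIV (f \<omega>)"
    and x: "x \<in> borel_measurable M"
  shows "(\<lambda>\<omega>. f \<omega> (x \<omega>)) \<in> borel_measurable M"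
proof -
  obtain s where s: "\<And>n. simple_function M (s n)" "\<And>\<omega>. \<omega> \<in> space M \<Longrightarrow> (\<lambda>n. s n \<omega>) \<longlonglongrightarrow> x \<omega>"
    using borel_measurable_implies_sequence_metric[OF x] by metis
  show ?thesis
  proof (rule borel_measurable_LIMSEQ_real)
    show "(\<lambda>n. f \<omega> (s n \<omega>)) \<longlonglongrightarrow> f \<omega> (x \<omega>)" if "\<omega> \<in> space M" for \<omega>
      by (rule continuous_on_tendsto_compose[OF cont[OF that] s(2)[OF that]]) simp_all
    show "(\<lambda>\<omega>. f \<omega> (s n \<omega>)) \<in> borel_measurable M" for n
      by (rule measurable_compose_countable'[where I = "s n ` space M" and g = "s n", OF f])
        (simp_all add: measurable_count_space_eq2 countable_finite simple_functionD[OF s(1)])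
  qed
qed

text \<open>For dense \<open>v\<close>, the inequalities \<open>2 * (u \<bullet> v) - (norm v)\<^sup>2 \<le> s\<^sup>2\<close> together say \<open>norm u \<le> s\<close>.\<close>

lemma borel_measurable_if_inner:
  fixes g :: "'m \<Rightarrow> 'a::{real_inner, second_countable_topology}"
  assumes [measurable]: "\<And>v. (\<lambda>\<omega>. g \<omega> \<bullet> v) \<in> borel_measurable M"
  shows "g \<in> borel_measurable M"
proof (rule borel_measurableI)
  obtain D :: "'a set" where D: "countable D" "\<And>X. open X \<Longrightarrow> X \<noteq> {} \<Longrightarrow> \<exists>d\<in>D. d \<in> X"
    by (erule countable_dense_setE)
  have norm_le: "norm u \<le> s \<longleftrightarrow> (\<forall>v\<in>D. 2 * (u \<bullet> v) - (norm v)\<^sup>2 \<le> s\<^sup>2)" if "s \<ge> 0" for u :: 'a and s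
  proof
    assume "norm u \<le> s"
    have "2 * (u \<bullet> v) - (norm v)\<^sup>2 \<le> (norm u)\<^sup>2" for v
      using zero_le_power2[of "norm (u - v)"] by (simp add: power2_norm_eq_inner algebra_simps inner_commute)
    then show "\<forall>v\<in>D. 2 * (u \<bullet> v) - (norm v)\<^sup>2 \<le> s\<^sup>2"
      using power_mono[OF \<open>norm u \<le> s\<close>, of 2] by (auto intro: order_trans)
  next
    assume *: "\<forall>v\<in>D. 2 * (u \<bullet> v) - (norm v)\<^sup>2 \<le> s\<^sup>2"
    have "\<not> s < norm u"
    proof
      assume "s < norm u"
      then have "s\<^sup>2 < (norm u)\<^sup>2" using that by (intro power_strict_mono) auto
      then have "u \<in> {v. s\<^sup>2 < 2 * (u \<bullet> v) - (norm v)\<^sup>2}" by (simp add: power2_norm_eq_inner)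
      moreover have "open {v. s\<^sup>2 < 2 * (u \<bullet> v) - (norm v)\<^sup>2}"
        by (intro open_Collect_less continuous_intros)
      ultimately obtain v where "v \<in> D" "s\<^sup>2 < 2 * (u \<bullet> v) - (norm v)\<^sup>2" using D(2) by blast
      with * show False by force
    qed
    then show "norm u \<le> s" by simp
  qed
  fix U :: "'a set" assume "open U"
  define I where "I = {(c, n). c \<in> D \<and> cball c (1 / real (Suc n)) \<subseteq> U}"
  have "countable I"
    by (rule countable_subset[of _ "D \<times> UNIV"]) (use D(1) in \<open>auto simp: I_def\<close>)
  have U: "U = (\<Union>(c, n)\<in>I. cball c (1 / real (Suc n)))"
  proof (intro equalityI subsetI)
    fix x assume "x \<in> U"
    then obtain \<epsilon> where \<epsilon>: "\<epsilon> > 0" "ball x \<epsilon> \<subseteq> U" using \<open>open U\<close> openE by blast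
    obtain n where n: "1 / real (Suc n) < \<epsilon> / 2" using nat_approx_posE[of "\<epsilon> / 2"] \<epsilon> by auto
    obtain c where c: "c \<in> D" "c \<in> ball x (1 / real (Suc n))" using D(2)[of "ball x (1 / real (Suc n))"] by auto
    have "cball c (1 / real (Suc n)) \<subseteq> ball x \<epsilon>"
    proof
      fix y assume "y \<in> cball c (1 / real (Suc n))"
      then show "y \<in> ball x \<epsilon>" using c(2) n dist_triangle[of x y c] by simp
    qed
    then have "(c, n) \<in> I" using c \<epsilon> by (auto simp: I_def)
    moreover have "x \<in> cball c (1 / real (Suc n))" using c by (simp add: dist_commute)
    ultimately show "x \<in> (\<Union>(c, n)\<in>I. cball c (1 / real (Suc n)))" by blast
  qed (auto simp: I_def)
  have "{\<omega> \<in> space M. g \<omega> \<in> cball c (1 / real (Suc n))} \<in> sets M" for c n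
  proof -
    have "{\<omega> \<in> space M. g \<omega> \<in> cball c (1 / real (Suc n))}
        = {\<omega> \<in> space M. \<forall>v\<in>D. 2 * ((g \<omega> - c) \<bullet> v) - (norm v)\<^sup>2 \<le> (1 / real (Suc n))\<^sup>2}"
      by (subst norm_le[symmetric]) (auto simp: dist_norm norm_minus_commute)
    also have "\<dots> \<in> sets M"
      unfolding inner_diff_left using D(1) by (intro sets.sets_Collect_countable_All') measurable
    finally show ?thesis .
  qed
  then have "(\<Union>(c, n)\<in>I. {\<omega> \<in> space M. g \<omega> \<in> cball c (1 / real (Suc n))}) \<in> sets M"
    using \<open>countable I\<close> by (intro sets.countable_UN'') (simp_all only: split_beta)
  moreover have "g -` U \<inter> space M = (\<Union>(c, n)\<in>I. {\<omega> \<in> space M. g \<omega> \<in> cball c (1 / real (Suc n))})"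
    by (subst U) force
  ultimately show "g -` U \<inter> space M \<in> sets M" by simp
qed

text \<open>The oracle is required to be a limit of difference quotients, a form that gradients and
  uniquely determined subgradients share. It makes inner products with the answer, hence the answer,
  measurable.\<close>

lemma measurable_iterate:
  fixes f :: "'m \<Rightarrow> 'a::{real_inner, second_countable_topology} \<Rightarrow> real" and g :: "'m \<Rightarrow> 'a \<Rightarrow> 'a"
  assumes A: "randomized_first_order A"
    and \<xi>: "\<xi> \<in> borel_measurable M"
    and f: "\<And>y. (\<lambda>\<omega>. f \<omega> y) \<in> borel_measurable M"
    and cont: "\<And>\<omega>. \<omega> \<in> space M \<Longrightarrow> continuous_on UNIV (f \<omega>)"
    and g: "\<And>\<omega> x v. \<omega> \<in> space M \<Longrightarrow>
        (\<lambda>n. real (Suc n) * (f \<omega> (x + v /\<^sub>R real (Suc n)) - f \<omega> x)) \<longlonglongrightarrow> g \<omega> x \<bullet> v"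
    and "t \<ge> 1"
  shows "(\<lambda>\<omega>. iterate A (\<xi> \<omega>) (f \<omega>) (g \<omega>) t) \<in> borel_measurable M"
  using \<open>t \<ge> 1\<close>
proof (induction t rule: less_induct)
  case (less t)
  define x where "x i \<omega> = iterate A (\<xi> \<omega>) (f \<omega>) (g \<omega>) i" for i \<omega>
  have x: "x i \<in> borel_measurable M" if "i \<in> {1..<t}" for i
    using less.IH[of i] that unfolding x_def by auto
  have fx: "(\<lambda>\<omega>. f \<omega> (x i \<omega>)) \<in> borel_measurable M" if "i \<in> {1..<t}" for i
    by (rule measurable_eval_continuous[OF f cont x[OF that]])
  have gx: "(\<lambda>\<omega>. g \<omega> (x i \<omega>)) \<in> borel_measurable M" if "i \<in> {1..<t}" for i
  proof (rule borel_measurable_if_inner)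
    fix v
    show "(\<lambda>\<omega>. g \<omega> (x i \<omega>) \<bullet> v) \<in> borel_measurable M"
    proof (rule borel_measurable_LIMSEQ_real[OF g])
      have "(\<lambda>\<omega>. f \<omega> (x i \<omega> + v /\<^sub>R real (Suc n))) \<in> borel_measurable M" for n
        using x[OF that] by (intro measurable_eval_continuous[OF f cont] borel_measurable_add) auto
      with fx[OF that] show "(\<lambda>\<omega>. real (Suc n) * (f \<omega> (x i \<omega> + v /\<^sub>R real (Suc n)) - f \<omega> (x i \<omega>)))
          \<in> borel_measurable M" for n by measurable
    qed
  qed
  have "(\<lambda>\<omega>. (\<xi> \<omega>, \<lambda>i\<in>{1..<t}. (f \<omega> (x i \<omega>), g \<omega> (x i \<omega>))))
      \<in> M \<rightarrow>\<^sub>M borel \<Otimes>\<^sub>M (\<Pi>\<^sub>M i\<in>{1..<t}. (borel \<Otimes>\<^sub>M borel))"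
    using \<xi> fx gx by (intro measurable_Pair measurable_restrict) auto
  moreover have "A t \<in> borel \<Otimes>\<^sub>M (\<Pi>\<^sub>M i\<in>{1..<t}. (borel \<Otimes>\<^sub>M borel)) \<rightarrow>\<^sub>M borel"
    using A less.prems unfolding randomized_first_order_def by auto
  ultimately show ?case
    unfolding iterate.simps[of A _ _ _ t] x_def by (rule measurable_compose)
qed

text \<open>A strict sublevel set of a continuous function is open, so a countable dense set detects
  whether it is empty.\<close>

lemma measurable_inf_val:
  fixes f :: "'m \<Rightarrow> 'a::{metric_space, second_countable_topology} \<Rightarrow> real"
  assumes [measurable]: "\<And>y. (\<lambda>\<omega>. f \<omega> y) \<in> borel_measurable M"
    and cont: "\<And>\<omega>. \<omega> \<in> space M \<Longrightarrow> continuous_on UNIV (f \<omega>)"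
    and bdd: "\<And>\<omega>. \<omega> \<in> space M \<Longrightarrow> bdd_below (range (f \<omega>))"
  shows "(\<lambda>\<omega>. inf_val (f \<omega>)) \<in> borel_measurable M"
  unfolding borel_measurable_iff_less
proof
  fix c
  obtain D :: "'a set" where D: "countable D" "\<And>X. open X \<Longrightarrow> X \<noteq> {} \<Longrightarrow> \<exists>d\<in>D. d \<in> X"
    by (erule countable_dense_setE)
  have "inf_val (f \<omega>) < c \<longleftrightarrow> (\<exists>x\<in>D. f \<omega> x < c)" if \<omega>: "\<omega> \<in> space M" for \<omega>
  proof
    assume "inf_val (f \<omega>) < c"
    then obtain x where "f \<omega> x < c" using bdd[OF \<omega>] unfolding inf_val_def by (subst (asm) cINF_less_iff) auto
    moreover have "open {x. f \<omega> x < c}" by (intro open_Collect_less cont[OF \<omega>] continuous_intros)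
    ultimately show "\<exists>x\<in>D. f \<omega> x < c" using D(2)[of "{x. f \<omega> x < c}"] by blast
  next
    assume "\<exists>x\<in>D. f \<omega> x < c"
    then show "inf_val (f \<omega>) < c" using bdd[OF \<omega>] unfolding inf_val_def by (subst cINF_less_iff) auto
  qed
  then have "{\<omega> \<in> space M. inf_val (f \<omega>) < c} = {\<omega> \<in> space M. \<exists>x\<in>D. f \<omega> x < c}"
    by (intro Collect_cong conj_cong) simp_all
  also have "\<dots> \<in> sets M" using D(1) by (intro sets.sets_Collect_countable_Ex') measurable
  finally show "{\<omega> \<in> space M. inf_val (f \<omega>) < c} \<in> sets M" .
qed

lemma space_fun_space: "space (fun_space \<F>) = \<F>"
  by (simp add: fun_space_def space_restrict_space space_PiM)

lemma measurable_fun_space_eval: "(\<lambda>F. F y) \<in> borel_measurable (fun_space \<F>)"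
  unfolding fun_space_def by (intro measurable_restrict_space1 measurable_component_singleton) auto

lemma measurable_fun_spaceI:
  assumes "\<And>y. (\<lambda>\<omega>. f \<omega> y) \<in> borel_measurable M" "\<And>\<omega>. \<omega> \<in> space M \<Longrightarrow> f \<omega> \<in> \<F>"
  shows "f \<in> M \<rightarrow>\<^sub>M fun_space \<F>"
  unfolding fun_space_def
  by (intro measurable_restrict_space2 measurable_PiM_single') (use assms in \<open>auto simp: space_PiM\<close>)

lemma space_seed_and_function:
  assumes "sets D = sets (fun_space \<F>)"
  shows "space (seed_and_function D) = UNIV \<times> \<F>"
  using sets_eq_imp_space_eq[OF assms]
  by (simp add: seed_and_function_def space_pair_measure space_fun_space)

text \<open>On \<open>S\<close> the oracle is determined by difference quotients. Nothing is known
  about \<open>G\<close> elsewhere, so measurability is proved for the trace on \<open>S\<close>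
  only.\<close>

lemma sets_slow_event:
  fixes G :: "('a::{real_inner, second_countable_topology} \<Rightarrow> real) \<Rightarrow> 'a \<Rightarrow> 'a"
  assumes A: "randomized_first_order A"
    and D: "sets D = sets (fun_space \<F>)" and S: "S \<in> sets D"
    and cont: "\<And>F. F \<in> S \<Longrightarrow> continuous_on UNIV F"
    and bdd: "\<And>F. F \<in> S \<Longrightarrow> bdd_below (range F)"
    and G: "\<And>F x v. F \<in> S \<Longrightarrow> (\<lambda>n. real (Suc n) * (F (x + v /\<^sub>R real (Suc n)) - F x)) \<longlonglongrightarrow> G F x \<bullet> v"
  shows "slow_event r \<rho> A G D \<inter> UNIV \<times> S \<in> sets (seed_and_function D)"
proof -
  let ?P = "seed_and_function D"
  have "S \<subseteq> \<F>" using sets.sets_into_space[OF S] sets_eq_imp_space_eq[OF D] by (simp add: space_fun_space)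
  have US: "UNIV \<times> S \<in> sets ?P" unfolding seed_and_function_def using S by (intro pair_measureI) auto
  define N where "N = restrict_space ?P (UNIV \<times> S)"
  have space_N: "space N = UNIV \<times> S"
    using \<open>S \<subseteq> \<F>\<close> by (auto simp: N_def space_restrict_space space_seed_and_function[OF D])
  have "fst \<in> borel_measurable ?P" unfolding seed_and_function_def
    using measurable_fst[of "uniform_measure lborel {0..1}" D] by (simp cong: measurable_cong_sets)
  then have 1: "fst \<in> borel_measurable N" unfolding N_def by (rule measurable_restrict_space1)
  have "(\<lambda>F. F y) \<in> borel_measurable D" for y :: 'a
    using measurable_fun_space_eval[of y \<F>] by (simp add: measurable_cong_sets[OF D refl])
  then have "(\<lambda>\<omega>. snd \<omega> y) \<in> borel_measurable ?P" for y :: 'a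
    unfolding seed_and_function_def by (rule measurable_compose[OF measurable_snd])
  then have 2: "(\<lambda>\<omega>. snd \<omega> y) \<in> borel_measurable N" for y :: 'a
    unfolding N_def by (rule measurable_restrict_space1)
  have 3: "(\<lambda>\<omega>. iterate A (fst \<omega>) (snd \<omega>) (G (snd \<omega>)) (n + 1)) \<in> borel_measurable N" for n
    by (rule measurable_iterate[OF A 1 2]; (rule cont G)?) (simp_all add: space_N mem_Times_iff)
  have 4: "(\<lambda>\<omega>. snd \<omega> (alg_output A (fst \<omega>) (snd \<omega>) (G (snd \<omega>)) n)) \<in> borel_measurable N" for n
    unfolding alg_output_def
    by (rule measurable_eval_continuous[OF 2 cont 3]) (simp add: space_N mem_Times_iff)
  have 5: "(\<lambda>\<omega>. inf_val (snd \<omega>)) \<in> borel_measurable N"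
    by (rule measurable_inf_val[OF 2 cont bdd]) (simp_all add: space_N mem_Times_iff)
  have "{\<omega> \<in> space N. limsup (\<lambda>n. ereal (r n * (snd \<omega> (alg_output A (fst \<omega>) (snd \<omega>) (G (snd \<omega>)) n) - inf_val (snd \<omega>)) / \<rho> (real n))) \<ge> 1} \<in> sets N"
    using 4 5 by measurable
  also have "{\<omega> \<in> space N. limsup (\<lambda>n. ereal (r n * (snd \<omega> (alg_output A (fst \<omega>) (snd \<omega>) (G (snd \<omega>)) n) - inf_val (snd \<omega>)) / \<rho> (real n))) \<ge> 1}
     = slow_event r \<rho> A G D \<inter> UNIV \<times> S"
    using \<open>S \<subseteq> \<F>\<close> by (auto simp: slow_event_def space_N space_seed_and_function[OF D])
  finally show ?thesis using US unfolding N_def by (auto simp: sets_restrict_space_iff)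
qed

section \<open>Probabilities over the seed and the objective\<close>

lemma prob_space_seed_and_function:
  assumes "prob_space D"
  shows "prob_space (seed_and_function D)"
proof -
  interpret D: prob_space D by fact
  interpret U: prob_space "uniform_measure lborel {0..1 :: real}"
    by (rule prob_space_uniform_measure) auto
  interpret pair_prob_space "uniform_measure lborel {0..1 :: real}" D ..
  show ?thesis unfolding seed_and_function_def by unfold_locales
qed

text \<open>By Fubini it suffices to fix the seed, which turns the algorithm into a deterministic
  one.\<close>

lemma measure_seed_and_function_eq_1:
  assumes "prob_space D" "E \<in> sets (seed_and_function D)" "\<And>\<xi>. AE F in D. (\<xi>, F) \<in> E"
  shows "measure (seed_and_function D) E = 1"
proof -
  interpret D: prob_space D by fact
  interpret P: prob_space "seed_and_function D" by (rule prob_space_seed_and_function[OF assms(1)])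
  interpret U: prob_space "uniform_measure lborel {0..1 :: real}"
    by (rule prob_space_uniform_measure) auto
  interpret UD: pair_prob_space "uniform_measure lborel {0..1 :: real}" D ..
  have "AE \<omega> in seed_and_function D. \<omega> \<in> E"
    unfolding seed_and_function_def
  proof (rule UD.AE_pair_measure)
    show "{\<omega> \<in> space (uniform_measure lborel {0..1} \<Otimes>\<^sub>M D). \<omega> \<in> E} \<in> sets (uniform_measure lborel {0..1} \<Otimes>\<^sub>M D)"
      using assms(2) sets.sets_into_space[OF assms(2)] unfolding seed_and_function_def
      by (simp add: Collect_conj_eq Int_absorb1)
  qed (use assms(3) in auto)
  then show ?thesis using P.prob_eq_1[OF assms(2)] by simp
qed

text \<open>\<open>X\<close> differs from \<open>E\<close> by a subset of a null set. This handles
  selections that are not measurable.\<close>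

lemma measure_completion_eq_1:
  assumes "prob_space P" "E \<in> sets P" "measure P E = 1" "E \<subseteq> X" "X \<subseteq> space P"
  shows "measure (completion P) X = 1"
proof -
  interpret prob_space P by fact
  interpret C: prob_space "completion P" by (rule prob_space_completion)
  have "space P - E \<in> null_sets P"
    using assms(2,3) by (auto simp: null_sets_def emeasure_eq_measure prob_compl)
  then have "X - E \<in> sets (completion P)" using assms(5) by (intro sets_completionI_sub) auto
  then have "X \<in> sets (completion P)"
    using sets.Un[OF sets_completionI_sets[OF assms(2)], of "X - E"] assms(4) by (simp add: Un_absorb1)
  then have "measure (completion P) E \<le> measure (completion P) X"
    using assms(4) by (intro C.finite_measure_mono)
  then show ?thesis using assms(2,3) C.prob_le_1[of X] by simp
qed

subsection \<open>Robust Nemirovski functions\<close>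

text \<open>Cauchy--Schwarz for the vectors \<open>(1, x)\<close> and
  \<open>(1, x + d)\<close>.\<close>

lemma sqrt_radial_lower:
  fixes x d :: "'a::real_inner"
  shows "sqrt (1 + (norm x)\<^sup>2) + (x /\<^sub>R sqrt (1 + (norm x)\<^sup>2)) \<bullet> d \<le> sqrt (1 + (norm (x + d))\<^sup>2)"
proof -
  define s where "s = sqrt (1 + (norm x)\<^sup>2)"
  define t where "t = sqrt (1 + (norm (x + d))\<^sup>2)"
  have s: "s > 0" "s * s = 1 + (norm x)\<^sup>2" by (auto simp: s_def add_pos_nonneg)
  have "1 + x \<bullet> (x + d) \<le> 1 + norm x * norm (x + d)" by (simp add: norm_cauchy_schwarz)
  also have "\<dots> \<le> sqrt ((1 + (norm x)\<^sup>2) * (1 + (norm (x + d))\<^sup>2))"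
    using zero_le_power2[of "norm x - norm (x + d)"]
    by (intro real_le_rsqrt) (simp add: power2_eq_square algebra_simps)
  also have "\<dots> = s * t" by (simp add: s_def t_def real_sqrt_mult)
  finally have "s * s + x \<bullet> d \<le> s * t" unfolding s(2) by (simp add: inner_add_right power2_norm_eq_inner)
  then have "s + (x \<bullet> d) / s \<le> t" using s(1) by (simp add: field_simps)
  then have "s + inverse s * (x \<bullet> d) \<le> t" by (simp only: divide_inverse_commute[of "x \<bullet> d" s])
  then show ?thesis unfolding s_def t_def inner_scaleR_left .
qed

text \<open>The inequality \<open>2 * s * t \<le> s * s + t * t\<close> for the two square roots,
  divided by \<open>2 * s\<close>; since \<open>s \<ge> 1\<close>, the quadratic coefficient is at
  most one half.\<close>

lemma sqrt_radial_upper: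
  fixes x d :: "'a::real_inner"
  shows "sqrt (1 + (norm (x + d))\<^sup>2)
    \<le> sqrt (1 + (norm x)\<^sup>2) + (x /\<^sub>R sqrt (1 + (norm x)\<^sup>2)) \<bullet> d + (norm d)\<^sup>2 / 2"
proof -
  define s where "s = sqrt (1 + (norm x)\<^sup>2)"
  define t where "t = sqrt (1 + (norm (x + d))\<^sup>2)"
  have s: "s \<ge> 1" "s * s = 1 + (norm x)\<^sup>2" by (auto simp: s_def)
  have "t * t = 1 + (norm (x + d))\<^sup>2" by (auto simp: t_def)
  then have t: "t * t = s * s + 2 * (x \<bullet> d) + (norm d)\<^sup>2"
    by (simp add: s(2) power2_norm_eq_inner algebra_simps inner_commute)
  have "0 \<le> (t - s)\<^sup>2" by simp
  then have "2 * (s * t) \<le> 2 * (s * s) + 2 * (x \<bullet> d) + (norm d)\<^sup>2"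
    using t by (simp add: power2_eq_square algebra_simps)
  then have "t \<le> (2 * (s * s) + 2 * (x \<bullet> d) + (norm d)\<^sup>2) / (2 * s)"
    using s(1) by (simp add: le_divide_eq mult_ac)
  also have "\<dots> = s + (x \<bullet> d) / s + (norm d)\<^sup>2 / (2 * s)"
    using s(1) by (simp add: add_divide_distrib)
  finally have "t \<le> s + (x \<bullet> d) / s + (norm d)\<^sup>2 / (2 * s)" .
  also have "(norm d)\<^sup>2 / (2 * s) \<le> (norm d)\<^sup>2 / 2" using s(1) by (intro divide_left_mono) auto
  finally have "t \<le> s + inverse s * (x \<bullet> d) + (norm d)\<^sup>2 / 2"
    by (simp only: divide_inverse_commute[of "x \<bullet> d" s])
  then show ?thesis unfolding s_def t_def inner_scaleR_left .
qed

lemma norm_radial_grad: "norm (x /\<^sub>R sqrt (1 + (norm x)\<^sup>2)) \<le> (1::real)"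
proof -
  have "norm x \<le> sqrt (1 + (norm x)\<^sup>2)" by (rule real_le_rsqrt) simp
  moreover have "sqrt (1 + (norm x)\<^sup>2) > 0" by (simp add: add_pos_nonneg)
  ultimately show ?thesis by (simp add: field_simps)
qed

text \<open>A robust version of Nemirovski's function: a smoothed maximum of the affine pieces
  \<open>b - v j \<bullet> x - 4 * \<gamma> * (j + 1)\<close>. The entry \<open>0\<close> makes the minimum explicit, and the radial entry
  takes over far from the origin, where queries would otherwise probe all directions at once.\<close>

definition chain_entry :: "real \<Rightarrow> real \<Rightarrow> (nat \<Rightarrow> 'a::real_inner) \<Rightarrow> 'a \<Rightarrow> nat \<Rightarrow> real" where
  "chain_entry \<gamma> b v x i = (case i of 0 \<Rightarrow> 0 | Suc 0 \<Rightarrow> 2 * sqrt (1 + (norm x)\<^sup>2) - 4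
      | Suc (Suc j) \<Rightarrow> b - v j \<bullet> x - 4 * \<gamma> * (real j + 1))"

definition chain_entry_grad :: "(nat \<Rightarrow> 'a::real_inner) \<Rightarrow> 'a \<Rightarrow> nat \<Rightarrow> 'a" where
  "chain_entry_grad v x i = (case i of 0 \<Rightarrow> 0 | Suc 0 \<Rightarrow> 2 *\<^sub>R (x /\<^sub>R sqrt (1 + (norm x)\<^sup>2))
      | Suc (Suc j) \<Rightarrow> - v j)"

text \<open>The smoothing \<open>2 * \<gamma>\<close> is half of the offset between neighbours:
  errors of \<gamma> in two inner products still leave the margin at which \<open>smax\<close>
  ignores an entry.\<close>

definition chain :: "real \<Rightarrow> nat \<Rightarrow> real \<Rightarrow> (nat \<Rightarrow> 'a::real_inner) \<Rightarrow> 'a \<Rightarrow> real" where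
  "chain \<gamma> T b v x = smax (2 * \<gamma>) {..<Suc (Suc T)} (chain_entry \<gamma> b v x)"

definition chain_grad :: "real \<Rightarrow> nat \<Rightarrow> real \<Rightarrow> (nat \<Rightarrow> 'a::real_inner) \<Rightarrow> 'a \<Rightarrow> 'a" where
  "chain_grad \<gamma> T b v x = (\<Sum>i<Suc (Suc T).
      smax_weight (2 * \<gamma>) {..<Suc (Suc T)} (chain_entry \<gamma> b v x) i *\<^sub>R chain_entry_grad v x i)"

declare sum.lessThan_Suc [simp del] lessThan_empty_iff [simp]

lemma chain_entry_simps [simp]:
  "chain_entry \<gamma> b v x 0 = 0"
  "chain_entry \<gamma> b v x (Suc 0) = 2 * sqrt (1 + (norm x)\<^sup>2) - 4"
  "chain_entry \<gamma> b v x (Suc (Suc j)) = b - v j \<bullet> x - 4 * \<gamma> * (real j + 1)"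
  "chain_entry_grad v x 0 = 0"
  "chain_entry_grad v x (Suc 0) = 2 *\<^sub>R (x /\<^sub>R sqrt (1 + (norm x)\<^sup>2))"
  "chain_entry_grad v x (Suc (Suc j)) = - v j"
  by (simp_all add: chain_entry_def chain_entry_grad_def)

text \<open>As a function of the random labels, a piece thus factors through a finite list, which
  makes it measurable.\<close>

lemma chain_cong: "(\<And>i. i < T \<Longrightarrow> v i = v' i) \<Longrightarrow> chain \<gamma> T b v x = chain \<gamma> T b v' x"
proof -
  assume *: "\<And>i. i < T \<Longrightarrow> v i = v' i"
  have eq: "chain_entry \<gamma> b v x i = chain_entry \<gamma> b v' x i" if "i < Suc (Suc T)" for i
    using that * by (auto simp: chain_entry_def split: nat.split)
  then have "smax_level (2 * \<gamma>) {..<Suc (Suc T)} (chain_entry \<gamma> b v x)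
      = smax_level (2 * \<gamma>) {..<Suc (Suc T)} (chain_entry \<gamma> b v' x)"
    unfolding smax_level_def by (intro arg_cong[of _ _ Eps] ext arg_cong2[of _ _ _ _ "(=)"] sum.cong) auto
  then show ?thesis unfolding chain_def smax_def using eq by simp
qed

lemma nat_cases_012: obtains "i = 0" | "i = Suc 0" | j where "i = Suc (Suc j)"
  by (metis not0_implies_Suc)

lemma chain_entry_lower:
  "chain_entry \<gamma> b v x i + chain_entry_grad v x i \<bullet> d \<le> chain_entry \<gamma> b v (x + d) i"
  using sqrt_radial_lower[of x d]
  by (cases i rule: nat_cases_012) (auto simp: inner_add_right)

lemma chain_entry_upper:
  "chain_entry \<gamma> b v (x + d) i \<le> chain_entry \<gamma> b v x i + chain_entry_grad v x i \<bullet> d + (norm d)\<^sup>2"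
  using sqrt_radial_upper[of x d]
  by (cases i rule: nat_cases_012) (auto simp: inner_add_right)

lemma sqrt_radial_lipschitz:
  "\<bar>sqrt (1 + (norm y)\<^sup>2) - sqrt (1 + (norm (x::'a::real_inner))\<^sup>2)\<bar> \<le> norm (y - x)"
  using lipschitz_if_bounded_subgradients[of "\<lambda>x. sqrt (1 + (norm x)\<^sup>2)" "\<lambda>x. x /\<^sub>R sqrt (1 + (norm x)\<^sup>2)" 1 y x]
    sqrt_radial_lower norm_radial_grad by (metis mult_1)

text \<open>The factor is 4 + 1: the radial entry is 2-Lipschitz, and Bessel's inequality bounds all
  affine entries together, independently of \<open>T\<close>.\<close>

lemma chain_entry_quadratic:
  assumes "orthonormal v"
  shows "(\<Sum>i<Suc (Suc T). (chain_entry \<gamma> b v (x + d) i - chain_entry \<gamma> b v x i)\<^sup>2) \<le> 5 * (norm d)\<^sup>2"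
proof -
  define s where "s = sqrt (1 + (norm (x + d))\<^sup>2) - sqrt (1 + (norm x)\<^sup>2)"
  have "\<bar>s\<bar> \<le> \<bar>norm d\<bar>" using sqrt_radial_lipschitz[of "x + d" x] by (simp add: s_def)
  then have "s\<^sup>2 \<le> (norm d)\<^sup>2" by (simp only: abs_le_square_iff)
  moreover have "(2 * sqrt (1 + (norm (x + d))\<^sup>2) - 2 * sqrt (1 + (norm x)\<^sup>2))\<^sup>2 = 4 * s\<^sup>2"
    by (simp add: s_def power2_eq_square algebra_simps)
  moreover have "(\<Sum>j<T. (v j \<bullet> x - v j \<bullet> (x + d))\<^sup>2) \<le> (norm d)\<^sup>2"
    using bessel[OF assms, of "{..<T}" d] by (simp add: inner_add_right)
  ultimately show ?thesis
    by (simp only: sum.lessThan_Suc_shift chain_entry_simps) simp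
qed

lemma chain_lower:
  assumes "\<gamma> > 0"
  shows "chain \<gamma> T b v x + chain_grad \<gamma> T b v x \<bullet> d \<le> chain \<gamma> T b v (x + d)"
proof -
  let ?I = "{..<Suc (Suc T)}"
  let ?w = "smax_weight (2 * \<gamma>) ?I (chain_entry \<gamma> b v x)"
  have "chain_grad \<gamma> T b v x \<bullet> d = (\<Sum>i\<in>?I. ?w i * (chain_entry_grad v x i \<bullet> d))"
    by (simp add: chain_grad_def inner_sum_left)
  also have "\<dots> \<le> (\<Sum>i\<in>?I. ?w i * (chain_entry \<gamma> b v (x + d) i - chain_entry \<gamma> b v x i))"
    using assms chain_entry_lower[of \<gamma> b v x _ d]
    by (intro sum_mono mult_left_mono smax_weight_nonneg) (auto simp: algebra_simps)
  finally show ?thesis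
    using smax_lower[of ?I "2 * \<gamma>" "chain_entry \<gamma> b v x" "chain_entry \<gamma> b v (x + d)"] assms
    by (simp add: chain_def)
qed

text \<open>The 2 is the curvature of the radial entry; the other term is the factor 5 of
  \<open>chain_entry_quadratic\<close> divided by the smoothing \<open>2 * \<gamma>\<close>.\<close>

lemma chain_sandwiched:
  assumes "\<gamma> > 0" "orthonormal v"
  shows "sandwiched (2 + 5 / (2 * \<gamma>)) (chain \<gamma> T b v) (chain_grad \<gamma> T b v)"
  unfolding sandwiched_def
proof (intro allI conjI)
  fix x d
  let ?I = "{..<Suc (Suc T)}"
  let ?w = "smax_weight (2 * \<gamma>) ?I (chain_entry \<gamma> b v x)"
  have "(\<Sum>i\<in>?I. ?w i * (chain_entry \<gamma> b v (x + d) i - chain_entry \<gamma> b v x i))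
      \<le> (\<Sum>i\<in>?I. ?w i * (chain_entry_grad v x i \<bullet> d + (norm d)\<^sup>2))"
    using assms chain_entry_upper[of \<gamma> b v x d]
    by (intro sum_mono mult_left_mono smax_weight_nonneg) (auto simp: algebra_simps)
  also have "\<dots> = chain_grad \<gamma> T b v x \<bullet> d + (norm d)\<^sup>2"
    using sum_smax_weight[of ?I "2 * \<gamma>" "chain_entry \<gamma> b v x"] assms
    by (simp add: chain_grad_def inner_sum_left distrib_left sum.distrib flip: sum_distrib_right)
  finally have "chain \<gamma> T b v (x + d) \<le> chain \<gamma> T b v x + (chain_grad \<gamma> T b v x \<bullet> d + (norm d)\<^sup>2)
      + (\<Sum>i\<in>?I. (chain_entry \<gamma> b v (x + d) i - chain_entry \<gamma> b v x i)\<^sup>2) / (4 * \<gamma>)"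
    using smax_upper[of ?I "2 * \<gamma>" "chain_entry \<gamma> b v (x + d)" "chain_entry \<gamma> b v x"] assms
    by (simp add: chain_def)
  also have "(\<Sum>i\<in>?I. (chain_entry \<gamma> b v (x + d) i - chain_entry \<gamma> b v x i)\<^sup>2) / (4 * \<gamma>)
      \<le> 5 * (norm d)\<^sup>2 / (4 * \<gamma>)"
    using assms by (intro divide_right_mono chain_entry_quadratic) auto
  finally show "chain \<gamma> T b v (x + d)
      \<le> chain \<gamma> T b v x + chain_grad \<gamma> T b v x \<bullet> d + (2 + 5 / (2 * \<gamma>)) / 2 * (norm d)\<^sup>2"
    by (simp add: field_simps)
qed (rule chain_lower[OF assms(1)])

lemma norm_orthonormal: "orthonormal e \<Longrightarrow> norm (e i) = 1"
  by (simp add: orthonormal_def norm_eq_sqrt_inner)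

lemma norm_chain_grad:
  assumes "\<gamma> > 0" "orthonormal v"
  shows "norm (chain_grad \<gamma> T b v x) \<le> 2"
proof -
  let ?I = "{..<Suc (Suc T)}"
  let ?w = "smax_weight (2 * \<gamma>) ?I (chain_entry \<gamma> b v x)"
  have w: "?w i \<ge> 0" for i using assms by (intro smax_weight_nonneg) auto
  have g: "norm (chain_entry_grad v x i) \<le> 2" for i
    using norm_radial_grad[of x] norm_orthonormal[OF assms(2)]
    by (cases i rule: nat_cases_012) (auto simp del: scaleR_scaleR)
  have "norm (chain_grad \<gamma> T b v x) \<le> (\<Sum>i\<in>?I. ?w i * norm (chain_entry_grad v x i))"
    unfolding chain_grad_def using w by (intro order_trans[OF norm_sum]) simp
  also have "\<dots> \<le> (\<Sum>i\<in>?I. ?w i * 2)" using w g by (intro sum_mono mult_left_mono)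
  also have "\<dots> = 2" using sum_smax_weight[of ?I "2 * \<gamma>" "chain_entry \<gamma> b v x"] assms
    by (simp flip: sum_distrib_right)
  finally show ?thesis .
qed

lemma chain_ge: "\<gamma> > 0 \<Longrightarrow> - \<gamma> \<le> chain \<gamma> T b v x"
  using smax_ge[of "{..<Suc (Suc T)}" "2 * \<gamma>" 0 "chain_entry \<gamma> b v x"] by (simp add: chain_def)

lemma chain_at_0_le:
  assumes "\<gamma> > 0" "b \<ge> 0"
  shows "chain \<gamma> T b v 0 \<le> b"
  unfolding chain_def
proof (rule smax_le)
  show "chain_entry \<gamma> b v 0 i \<le> b" for i
    using assms by (cases i rule: nat_cases_012) auto
qed (use assms in auto)

text \<open>At \<open>z\<close> the affine entries are at most \<open>- 4 * \<gamma>\<close> and the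
  radial one is at most -1, so only the zero entry is active. The smoothed maximum is then that
  entry minus half the smoothing.\<close>

lemma chain_min:
  assumes "\<gamma> > 0" "\<gamma> \<le> 1/2" "norm z \<le> 1" "\<And>i. i < T \<Longrightarrow> v i \<bullet> z = b"
  shows "chain \<gamma> T b v z = - \<gamma>"
proof -
  let ?I = "{..<Suc (Suc T)}"
  have "(norm z)\<^sup>2 \<le> 1" using power_mono[OF assms(3), of 2] by simp
  then have "sqrt (1 + (norm z)\<^sup>2) \<le> sqrt ((3/2)\<^sup>2)" by (intro real_sqrt_le_mono) (simp add: power2_eq_square)
  then have s: "sqrt (1 + (norm z)\<^sup>2) \<le> 3/2" by simp
  have low: "chain_entry \<gamma> b v z i \<le> - (2 * \<gamma>)" if "i \<in> ?I - {0}" for i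
    using that s assms by (cases i rule: nat_cases_012) auto
  define h' where "h' i = (if i = 0 then 0 else - (2 * \<gamma>))" for i :: nat
  have "smax (2 * \<gamma>) ?I (chain_entry \<gamma> b v z) = smax (2 * \<gamma>) ?I h'"
    using assms(1) low by (intro smax_local(1)[where K = "{0}" and m = 0]) (auto simp: h'_def)
  moreover have "smax (2 * \<gamma>) ?I h' \<le> - \<gamma>"
  proof -
    have "smax_level (2 * \<gamma>) ?I h' = - (2 * \<gamma>)"
    proof (rule smax_level_unique)
      show "(\<Sum>i\<in>?I. max 0 (h' i - - (2 * \<gamma>))) = 2 * \<gamma>"
        using assms(1) by (simp only: sum.lessThan_Suc_shift) (simp add: h'_def)
      show "(\<Sum>i\<in>?I. max 0 (h' i - smax_level (2 * \<gamma>) ?I h')) = 2 * \<gamma>"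
        using assms(1) by (intro smax_level) auto
    qed (use assms(1) in auto)
    moreover have "(\<Sum>i\<in>?I. (max 0 (h' i - - (2 * \<gamma>)))\<^sup>2) = (2 * \<gamma>)\<^sup>2"
      using assms(1) by (simp only: sum.lessThan_Suc_shift) (simp add: h'_def)
    ultimately show ?thesis unfolding smax_def using assms(1) by (simp add: power2_eq_square)
  qed
  ultimately show ?thesis using chain_ge[OF assms(1), of T b v z] by (simp add: chain_def)
qed

text \<open>Far out the radial entry alone is at least 8. Otherwise the last affine entry suffices:
  its offset \<open>4 * \<gamma> * T\<close> takes at most \<open>b / 4\<close> and the inner
  product at most \<open>b / 16\<close>.\<close>

lemma chain_gap:
  assumes "\<gamma> > 0" "16 * \<gamma> * T \<le> b" "b \<le> 1" "T \<ge> 1"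
    and far: "norm x \<ge> 6 \<or> \<bar>v (T - 1) \<bullet> x\<bar> \<le> \<gamma>"
  shows "b / 2 \<le> chain \<gamma> T b v x + \<gamma>"
proof -
  have "16 * \<gamma> * 1 \<le> 16 * \<gamma> * T" using assms by (intro mult_left_mono) auto
  then have \<gamma>: "16 * \<gamma> \<le> b" using assms(2) by simp
  have le: "chain_entry \<gamma> b v x i \<le> chain \<gamma> T b v x + \<gamma>" if "i < Suc (Suc T)" for i
    using smax_ge[of "{..<Suc (Suc T)}" "2 * \<gamma>" i "chain_entry \<gamma> b v x"] assms(1) that
    by (simp add: chain_def)
  show ?thesis
  proof (cases "norm x \<ge> 6")
    case True
    have "norm x \<le> sqrt (1 + (norm x)\<^sup>2)" by (rule real_le_rsqrt) simp
    with True le[of "Suc 0"] assms(3) show ?thesis by simp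
  next
    case False
    have "b - v (T - 1) \<bullet> x - 4 * \<gamma> * T \<le> chain \<gamma> T b v x + \<gamma>"
      using le[of "Suc T"] assms(4) by (cases T) (auto simp: algebra_simps)
    then show ?thesis using False far assms(2) \<gamma> by (auto simp: abs_le_iff)
  qed
qed

text \<open>Unless \<open>x\<close> correlates with one of the directions \<open>v j\<close>, \<open>j \<ge> s\<close>, a query at \<open>x\<close> reveals at
  most \<open>v s\<close> among them.\<close>

lemma chain_local:
  assumes "\<gamma> > 0" "\<gamma> \<le> 1/4" "0 \<le> b" "b \<le> 1" "s < T" "orthonormal v" "orthonormal v'"
    and eq: "\<And>j. j \<le> s \<Longrightarrow> v j = v' j"
    and far: "norm x \<ge> 6 \<or> (\<forall>j. s \<le> j \<and> j < T \<longrightarrow> \<bar>v j \<bullet> x\<bar> \<le> \<gamma> \<and> \<bar>v' j \<bullet> x\<bar> \<le> \<gamma>)"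
  shows "chain \<gamma> T b v x = chain \<gamma> T b v' x" "chain_grad \<gamma> T b v x = chain_grad \<gamma> T b v' x"
proof -
  let ?I = "{..<Suc (Suc T)}"
  let ?h = "chain_entry \<gamma> b v x" and ?h' = "chain_entry \<gamma> b v' x"
  \<comment> \<open>\<open>K\<close> consists of entries that \<open>v\<close> and \<open>v'\<close>
    share, and its member \<open>m\<close> dominates all entries outside \<open>K\<close> by the
    smoothing parameter.\<close>
  have "\<exists>K m. m \<in> K \<and> K \<subseteq> {..<Suc (Suc (Suc s))} \<and> (\<forall>i\<in>?I - K. ?h i \<le> ?h m - 2 * \<gamma> \<and> ?h' i \<le> ?h m - 2 * \<gamma>)"
  proof (cases "norm x \<ge> 6")
    case True
    have *: "norm x \<le> sqrt (1 + (norm x)\<^sup>2)" by (rule real_le_rsqrt) simp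
    \<comment> \<open>Affine entries are at most \<open>1 + norm x\<close> and the radial one is at
      least \<open>2 * norm x - 4\<close>, which is larger by at least 1 from radius 6 on.\<close>
    have "?h i \<le> ?h 1 - 2 * \<gamma> \<and> ?h' i \<le> ?h 1 - 2 * \<gamma>" if i: "i \<in> ?I - {0, 1}" for i
    proof -
      obtain j where j: "i = Suc (Suc j)" using i by (cases i rule: nat_cases_012) auto
      have "\<bar>v j \<bullet> x\<bar> \<le> norm x" "\<bar>v' j \<bullet> x\<bar> \<le> norm x"
        using Cauchy_Schwarz_ineq2[of "v j" x] Cauchy_Schwarz_ineq2[of "v' j" x] norm_orthonormal assms(6,7)
        by (metis mult_1)+
      moreover have "0 \<le> 4 * \<gamma> * (real j + 1)" using assms(1) by simp
      ultimately show ?thesis using * True assms(1-4)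
        unfolding j One_nat_def chain_entry_simps abs_le_iff by (intro conjI) linarith+
    qed
    then show ?thesis by (intro exI[of _ "{0, 1}"] exI[of _ 1]) auto
  next
    case False
    \<comment> \<open>An offset difference of at least \<open>4 * \<gamma>\<close> pays for two
      errors of \<gamma> and for the margin \<open>2 * \<gamma>\<close>.\<close>
    have "?h i \<le> ?h (Suc (Suc s)) - 2 * \<gamma> \<and> ?h' i \<le> ?h (Suc (Suc s)) - 2 * \<gamma>"
      if i: "i \<in> ?I - {..<Suc (Suc (Suc s))}" for i
    proof -
      obtain j where j: "i = Suc (Suc j)" using i by (cases i rule: nat_cases_012) auto
      have "\<gamma> * (real s + 2) \<le> \<gamma> * (real j + 1)" using i assms(1) by (intro mult_left_mono) (auto simp: j)
      moreover have "\<bar>v j \<bullet> x\<bar> \<le> \<gamma> \<and> \<bar>v' j \<bullet> x\<bar> \<le> \<gamma>" "\<bar>v s \<bullet> x\<bar> \<le> \<gamma>"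
        using far False i assms(5) by (auto simp: j)
      ultimately show ?thesis by (simp add: j abs_le_iff algebra_simps)
    qed
    then show ?thesis by (intro exI[of _ "{..<Suc (Suc (Suc s))}"] exI[of _ "Suc (Suc s)"]) auto
  qed
  then obtain K m where K: "m \<in> K" "K \<subseteq> {..<Suc (Suc (Suc s))}"
    and low: "\<And>i. i \<in> ?I - K \<Longrightarrow> ?h i \<le> ?h m - 2 * \<gamma>" "\<And>i. i \<in> ?I - K \<Longrightarrow> ?h' i \<le> ?h m - 2 * \<gamma>"
    by blast
  have KI: "K \<subseteq> ?I" using K(2) assms(5) by force
  have eq_h: "?h i = ?h' i" if "i \<in> K" for i
    using that K(2) eq by (cases i rule: nat_cases_012) (auto simp: subset_iff)
  have eq_g: "chain_entry_grad v x i = chain_entry_grad v' x i" if "i \<in> K" for i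
    using that K(2) eq by (cases i rule: nat_cases_012) (auto simp: subset_iff)
  have low': "?h i \<le> ?h' m - 2 * \<gamma>" "?h' i \<le> ?h' m - 2 * \<gamma>" if "i \<in> ?I - K" for i
    using low[OF that] eq_h[OF K(1)] by auto
  have \<gamma>: "2 * \<gamma> > 0" using assms(1) by simp
  note local = smax_local[OF _ \<gamma> K(1) KI, of ?h ?h', OF _ eq_h low]
    smax_local(3)[OF _ \<gamma> K(1) KI, of ?h' ?h, OF _ eq_h[symmetric] low'(2,1)]
  show "chain \<gamma> T b v x = chain \<gamma> T b v' x" unfolding chain_def by (rule local(1)) auto
  show "chain_grad \<gamma> T b v x = chain_grad \<gamma> T b v' x"
    unfolding chain_grad_def
  proof (rule sum.cong)
    fix i assume i: "i \<in> ?I"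
    show "smax_weight (2 * \<gamma>) ?I ?h i *\<^sub>R chain_entry_grad v x i
        = smax_weight (2 * \<gamma>) ?I ?h' i *\<^sub>R chain_entry_grad v' x i"
      using local(2)[of i] local(3)[of i] local(4)[of i] eq_g[of i] i by (cases "i \<in> K") auto
  qed simp
qed

subsection \<open>The random objective\<close>

lemma summable_norm_bound:
  fixes f :: "nat \<Rightarrow> 'a::{real_normed_vector, complete_space}"
  assumes bound: "\<And>n. norm (f n) \<le> c n" and c: "summable c"
  shows "summable f" "norm (suminf f) \<le> suminf c"
proof -
  have "Cauchy (\<lambda>n. sum f {..<n})"
  proof (rule metric_CauchyI)
    fix \<epsilon> :: real assume "\<epsilon> > 0"
    then obtain N where N: "\<forall>m\<ge>N. \<forall>n. norm (sum c {m..<n}) < \<epsilon>"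
      using c unfolding summable_Cauchy by blast
    have *: "dist (sum f {..<m}) (sum f {..<n}) < \<epsilon>" if "m \<ge> N" "m \<le> n" for m n
    proof -
      have "dist (sum f {..<m}) (sum f {..<n}) = norm (sum f {m..<n})"
        using sum_diff_nat_ivl[of 0 m n f] that
        by (simp add: dist_norm norm_minus_commute[of "sum f {0..<m}"] lessThan_atLeast0)
      also have "\<dots> \<le> (\<Sum>i\<in>{m..<n}. c i)"
        using bound by (intro order_trans[OF norm_sum] sum_mono)
      also have "\<dots> \<le> norm (sum c {m..<n})" by simp
      also have "\<dots> < \<epsilon>" using N that(1) by blast
      finally show ?thesis .
    qed
    have "dist (sum f {..<m}) (sum f {..<n}) < \<epsilon>" if "m \<ge> N" "n \<ge> N" for m n
      using *[of m n] *[of n m] that by (cases "m \<le> n") (simp_all add: dist_commute)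
    then show "\<exists>N. \<forall>m\<ge>N. \<forall>n\<ge>N. dist (sum f {..<m}) (sum f {..<n}) < \<epsilon>" by blast
  qed
  then show f: "summable f"
    by (simp add: Cauchy_convergent_iff summable_iff_convergent)
  show "norm (suminf f) \<le> suminf c"
  proof (rule LIMSEQ_le)
    show "(\<lambda>n. norm (sum f {..<n})) \<longlonglongrightarrow> norm (suminf f)"
      using f by (intro tendsto_norm summable_LIMSEQ)
    show "(\<lambda>n. sum c {..<n}) \<longlonglongrightarrow> suminf c" using c by (rule summable_LIMSEQ)
    show "\<exists>N. \<forall>n\<ge>N. norm (sum f {..<n}) \<le> sum c {..<n}"
      using bound by (intro exI allI impI order_trans[OF norm_sum] sum_mono)
  qed
qed

lemma half_powers_sums: "(\<lambda>k. (1/2 :: real) ^ (k + Suc n)) sums ((1/2) ^ n)"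
proof -
  have "(\<lambda>k. (1/2 :: real) ^ Suc n * (1/2) ^ k) sums ((1/2) ^ Suc n * (1 / (1 - 1/2)))"
    by (intro sums_mult geometric_sums) simp
  then show ?thesis by (simp add: power_add mult_ac)
qed

text \<open>The two classes differ only in the weights \<open>a\<close>. The vector
  \<open>e (k, i, j)\<close> is candidate \<open>j\<close> for direction \<open>i\<close> of piece
  \<open>k\<close>. Pieces are 2-Lipschitz, so the bound on \<open>a\<close> makes their weighted
  sum 1-Lipschitz.\<close>

locale hard_instance =
  fixes e :: "nat \<times> nat \<times> nat \<Rightarrow> 'a::{real_inner, polish_space}"
    and a :: "nat \<Rightarrow> real" and T :: "nat \<Rightarrow> nat"
  assumes e: "orthonormal e"
    and a_pos: "\<And>k. a k > 0" and a_le: "\<And>k. a k \<le> (1/2) ^ (k + 2)"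
    and T: "\<And>k. T k \<ge> 2"
begin

text \<open>With this coefficient a block of \<open>T k\<close> orthonormal vectors has norm
  \<open>(1/2) ^ (k + 1)\<close>; these norms sum to 1.\<close>

definition level :: "nat \<Rightarrow> real" where "level k = (1/2) ^ (k + 1) / sqrt (T k)"

text \<open>The largest offset within a piece is then a quarter of its level.\<close>

definition width :: "nat \<Rightarrow> real" where "width k = level k / (16 * T k)"

definition dir :: "(nat \<times> nat \<Rightarrow> nat) \<Rightarrow> nat \<Rightarrow> nat \<Rightarrow> 'a" where
  "dir \<omega> k i = e (k, i, \<omega> (k, i))"

definition piece :: "(nat \<times> nat \<Rightarrow> nat) \<Rightarrow> nat \<Rightarrow> 'a \<Rightarrow> real" where
  "piece \<omega> k = chain (width k) (T k) (level k) (dir \<omega> k)"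

definition piece_grad :: "(nat \<times> nat \<Rightarrow> nat) \<Rightarrow> nat \<Rightarrow> 'a \<Rightarrow> 'a" where
  "piece_grad \<omega> k = chain_grad (width k) (T k) (level k) (dir \<omega> k)"

definition curvature :: "nat \<Rightarrow> real" where "curvature k = 2 + 5 / (2 * width k)"

definition obj :: "(nat \<times> nat \<Rightarrow> nat) \<Rightarrow> 'a \<Rightarrow> real" where
  "obj \<omega> x = (\<Sum>k. a k * piece \<omega> k x)"

definition obj_grad :: "(nat \<times> nat \<Rightarrow> nat) \<Rightarrow> 'a \<Rightarrow> 'a" where
  "obj_grad \<omega> x = (\<Sum>k. a k *\<^sub>R piece_grad \<omega> k x)"

definition minimizer :: "(nat \<times> nat \<Rightarrow> nat) \<Rightarrow> 'a" where
  "minimizer \<omega> = (\<Sum>k. level k *\<^sub>R (\<Sum>i<T k. dir \<omega> k i))"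

lemma T_pos: "T k \<ge> 1" "real (T k) > 0"
  using T[of k] by auto

lemma level_pos: "level k > 0"
  using T_pos[of k] by (simp add: level_def)

lemma level_le: "level k \<le> 1/2"
proof -
  have "level k \<le> (1/2) ^ (k + 1) / 1"
    unfolding level_def using T_pos[of k] by (intro divide_left_mono) auto
  also have "\<dots> \<le> 1/2" using power_decreasing[of 1 "k + 1" "1/2 :: real"] by simp
  finally show ?thesis .
qed

lemma width_pos: "width k > 0"
  using level_pos[of k] T_pos[of k] by (simp add: width_def)

lemma width_T: "16 * width k * T k = level k"
  using T_pos[of k] by (simp add: width_def)

lemma width_le: "width k \<le> 1/32"
proof -
  have "16 * width k * 1 \<le> 16 * width k * T k"
    using T_pos[of k] width_pos[of k] by (intro mult_left_mono) auto
  then show ?thesis using width_T[of k] level_le[of k] by simp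
qed

lemma orthonormal_dir: "orthonormal (dir \<omega> k)"
  using e by (auto simp: orthonormal_def dir_def)

lemma dir_inner: "dir \<omega> k i \<bullet> dir \<omega> l j = of_bool (k = l \<and> i = j)"
  using e by (auto simp: orthonormal_def dir_def)

lemma piece_sandwiched: "sandwiched (curvature k) (piece \<omega> k) (piece_grad \<omega> k)"
  unfolding curvature_def piece_def piece_grad_def
  by (intro chain_sandwiched width_pos orthonormal_dir)

lemma piece_lower: "piece \<omega> k x + piece_grad \<omega> k x \<bullet> h \<le> piece \<omega> k (x + h)"
  unfolding piece_def piece_grad_def by (intro chain_lower width_pos)

lemma norm_piece_grad: "norm (piece_grad \<omega> k x) \<le> 2"
  unfolding piece_grad_def by (intro norm_chain_grad width_pos orthonormal_dir)

lemma piece_lipschitz: "\<bar>piece \<omega> k y - piece \<omega> k x\<bar> \<le> 2 * norm (y - x)"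
  by (rule lipschitz_if_bounded_subgradients[OF piece_lower norm_piece_grad])

lemma piece_ge: "- width k \<le> piece \<omega> k x"
  unfolding piece_def by (intro chain_ge width_pos)

lemma piece_at_0: "piece \<omega> k 0 \<le> level k"
  unfolding piece_def using level_pos[of k] by (intro chain_at_0_le width_pos) simp

lemma abs_piece_le: "\<bar>piece \<omega> k x\<bar> \<le> 1 + 2 * norm x"
  using piece_lipschitz[of \<omega> k x 0] piece_at_0[of \<omega> k] piece_ge[of k \<omega> 0] level_le[of k] width_le[of k]
  by simp

lemma summable_weighted:
  assumes "\<And>k. \<bar>f k\<bar> \<le> C"
  shows "summable (\<lambda>k. a k * f k)"
proof (rule summable_norm_bound(1))
  show "norm (a k * f k) \<le> (1/2) ^ (k + 2) * C" for k
    using mult_mono[OF a_le assms[of k]] a_pos[of k] by (simp add: abs_mult)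
  show "summable (\<lambda>k. (1/2) ^ (k + 2) * C)"
    using half_powers_sums[of 1] by (intro summable_mult2) (simp add: sums_iff)
qed

lemma summable_piece: "summable (\<lambda>k. a k * piece \<omega> k x)"
  by (rule summable_weighted[OF abs_piece_le])



lemma grad_bound: "norm (a k *\<^sub>R piece_grad \<omega> k x) \<le> (1/2) ^ (k + 1)"
  using mult_mono[OF a_le[of k] norm_piece_grad[of \<omega> k x]] a_pos[of k] by simp

lemma summable_grad: "summable (\<lambda>k. a k *\<^sub>R piece_grad \<omega> k x)"
  using half_powers_sums[of 0] by (intro summable_norm_bound(1)[OF grad_bound]) (simp add: sums_iff)

lemma norm_obj_grad: "norm (obj_grad \<omega> x) \<le> 1"
proof -
  have "norm (obj_grad \<omega> x) \<le> (\<Sum>k. (1/2) ^ (k + 1))"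
    unfolding obj_grad_def using half_powers_sums[of 0]
    by (intro summable_norm_bound(2)[OF grad_bound]) (simp add: sums_iff)
  then show ?thesis using half_powers_sums[of 0] by (simp add: sums_iff)
qed

lemma obj_grad_inner_sums: "(\<lambda>k. a k * (piece_grad \<omega> k x \<bullet> h)) sums (obj_grad \<omega> x \<bullet> h)"
  using bounded_linear.sums[OF bounded_linear_inner_left summable_sums[OF summable_grad], of \<omega> x h]
  by (simp add: obj_grad_def)

lemma obj_sums: "(\<lambda>k. a k * piece \<omega> k x) sums obj \<omega> x"
  unfolding obj_def by (rule summable_sums[OF summable_piece])

lemma obj_lower: "obj \<omega> x + obj_grad \<omega> x \<bullet> h \<le> obj \<omega> (x + h)"
proof (rule sums_le)
  show "a k * piece \<omega> k x + a k * (piece_grad \<omega> k x \<bullet> h) \<le> a k * piece \<omega> k (x + h)" for k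
    using mult_left_mono[OF piece_lower[of \<omega> k x h]] a_pos[of k] by (simp add: distrib_left)
  show "(\<lambda>k. a k * piece \<omega> k x + a k * (piece_grad \<omega> k x \<bullet> h)) sums (obj \<omega> x + obj_grad \<omega> x \<bullet> h)"
    by (rule sums_add[OF obj_sums obj_grad_inner_sums])
qed (rule obj_sums)

lemma obj_lipschitz: "\<bar>obj \<omega> y - obj \<omega> x\<bar> \<le> norm (y - x)"
proof -
  have "\<bar>obj \<omega> y - obj \<omega> x\<bar> \<le> 1 * norm (y - x)"
    by (rule lipschitz_if_bounded_subgradients[OF obj_lower norm_obj_grad])
  then show ?thesis by simp
qed

lemma continuous_obj: "continuous_on UNIV (obj \<omega>)"
  by (rule lipschitz_on_continuous_on[of 1], rule lipschitz_onI)
    (simp_all add: dist_norm obj_lipschitz)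

text \<open>Curvatures are unbounded in \<open>k\<close>, so the weights must absorb them; the
  shares allotted to the pieces sum to 1.\<close>

lemma obj_sandwiched:
  assumes "\<And>k. a k * curvature k \<le> (1/2) ^ (k + 1)"
  shows "sandwiched 1 (obj \<omega>) (obj_grad \<omega>)"
  unfolding sandwiched_def
proof (intro allI conjI obj_lower)
  fix x h
  show "obj \<omega> (x + h) \<le> obj \<omega> x + obj_grad \<omega> x \<bullet> h + 1 / 2 * (norm h)\<^sup>2"
  proof (rule sums_le)
    fix k
    have "a k * piece \<omega> k (x + h) \<le> a k * (piece \<omega> k x + piece_grad \<omega> k x \<bullet> h + curvature k / 2 * (norm h)\<^sup>2)"
      using piece_sandwiched[of k \<omega>] a_pos[of k] by (intro mult_left_mono) (auto simp: sandwiched_def)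
    moreover have "a k * curvature k * ((norm h)\<^sup>2 / 2) \<le> (1/2) ^ (k + 1) * ((norm h)\<^sup>2 / 2)"
      by (intro mult_right_mono assms) auto
    ultimately show "a k * piece \<omega> k (x + h)
        \<le> a k * piece \<omega> k x + a k * (piece_grad \<omega> k x \<bullet> h) + (1/2) ^ (k + 1) * ((norm h)\<^sup>2 / 2)"
      by (simp add: distrib_left)
  next
    have "(\<lambda>k. (1/2) ^ (k + 1) * ((norm h)\<^sup>2 / 2)) sums (1 * ((norm h)\<^sup>2 / 2))"
      using half_powers_sums[of 0] by (intro sums_mult2) simp
    then show "(\<lambda>k. a k * piece \<omega> k x + a k * (piece_grad \<omega> k x \<bullet> h) + (1/2) ^ (k + 1) * ((norm h)\<^sup>2 / 2))
        sums (obj \<omega> x + obj_grad \<omega> x \<bullet> h + 1 / 2 * (norm h)\<^sup>2)"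
      using sums_add[OF sums_add[OF obj_sums[of \<omega> x] obj_grad_inner_sums[of \<omega> x h]]] by fastforce
  qed (rule obj_sums)
qed

text \<open>For each \<open>K\<close> the first \<open>K\<close> summands are smooth and the others have a small Lipschitz constant.
  Unlike differentiability, these bounds involve only closed conditions on the values of \<open>F\<close>.\<close>

definition flat_functions :: "('a \<Rightarrow> real) set" where
  "flat_functions = {F. \<forall>K x h. F (x + h) + F (x - h) - 2 * F x
      \<le> (\<Sum>k<K. a k * curvature k) * (norm h)\<^sup>2 + 4 * (1/2) ^ (K + 1) * norm h}"

text \<open>Summands before \<open>K\<close> are bounded by their curvature, later ones by the
  Lipschitz constant 2 applied to both increments; the weights from \<open>K\<close> on sum to at
  most \<open>(1/2) ^ (K + 1)\<close>.\<close>

lemma obj_flat: "obj \<omega> \<in> flat_functions"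
  unfolding flat_functions_def
proof (intro CollectI allI)
  fix K and x h :: 'a
  define u where "u k = (if k < K then a k * curvature k * (norm h)\<^sup>2 else 0)" for k
  define w where "w k = (if k < K then 0 else (1/2 :: real) ^ (k + 2))" for k
  have "u sums (\<Sum>k<K. u k)" by (rule sums_finite) (auto simp: u_def)
  moreover have "(\<Sum>k<K. u k) = (\<Sum>k<K. a k * curvature k) * (norm h)\<^sup>2"
    by (simp add: u_def sum_distrib_right)
  ultimately have u: "u sums ((\<Sum>k<K. a k * curvature k) * (norm h)\<^sup>2)" by simp
  have "(\<lambda>k. w (k + K)) sums ((1/2) ^ (K + 1))"
    using half_powers_sums[of "K + 1"] by (simp add: w_def add.assoc)
  then have "w sums ((1/2) ^ (K + 1) + (\<Sum>k<K. w k))" by (subst (asm) sums_iff_shift)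
  then have w: "w sums ((1/2) ^ (K + 1))" by (simp add: w_def)
  show "obj \<omega> (x + h) + obj \<omega> (x - h) - 2 * obj \<omega> x
      \<le> (\<Sum>k<K. a k * curvature k) * (norm h)\<^sup>2 + 4 * (1/2) ^ (K + 1) * norm h"
  proof (rule sums_le)
    fix k
    define D where "D = piece \<omega> k (x + h) + piece \<omega> k (x - h) - 2 * piece \<omega> k x"
    have "D \<le> curvature k * (norm h)\<^sup>2"
      using piece_sandwiched[of k \<omega>, unfolded sandwiched_def, rule_format, of x h]
        piece_sandwiched[of k \<omega>, unfolded sandwiched_def, rule_format, of x "- h"]
      by (simp add: D_def)
    moreover have "D \<le> 4 * norm h"
      using piece_lipschitz[of \<omega> k "x + h" x] piece_lipschitz[of \<omega> k "x - h" x] by (simp add: D_def abs_le_iff)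
    ultimately have "a k * D \<le> a k * (curvature k * (norm h)\<^sup>2)" "a k * D \<le> a k * (4 * norm h)"
      using a_pos[of k] by (auto intro!: mult_left_mono)
    moreover have "a k * (4 * norm h) \<le> (1/2) ^ (k + 2) * (4 * norm h)"
      by (intro mult_right_mono a_le) simp
    ultimately have "a k * D \<le> u k + w k * (4 * norm h)"
      by (cases "k < K") (auto simp: u_def w_def mult.assoc simp del: power_Suc)
    then show "a k * piece \<omega> k (x + h) + a k * piece \<omega> k (x - h) - 2 * (a k * piece \<omega> k x)
        \<le> u k + w k * (4 * norm h)"
      by (simp add: D_def algebra_simps)
  next
    show "(\<lambda>k. u k + w k * (4 * norm h)) sums
        ((\<Sum>k<K. a k * curvature k) * (norm h)\<^sup>2 + 4 * (1/2) ^ (K + 1) * norm h)"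
      using sums_add[OF u sums_mult2[OF w, of "4 * norm h"]] by (simp add: mult_ac)
  qed (intro sums_add sums_diff sums_mult obj_sums)
qed

lemma minimizer_term_norm: "norm (level k *\<^sub>R (\<Sum>i<T k. dir \<omega> k i)) \<le> (1/2) ^ (k + 1)"
proof -
  have "(norm (\<Sum>i<T k. dir \<omega> k i))\<^sup>2 = T k"
    using orthonormal_expansion_norm[OF orthonormal_dir, of "{..<T k}" "\<lambda>_. 1" \<omega> k] by simp
  then have "norm (\<Sum>i<T k. dir \<omega> k i) = sqrt (T k)"
    by (metis norm_ge_zero real_sqrt_unique)
  then show ?thesis using T_pos[of k] level_pos[of k] by (simp add: level_def)
qed

lemma norm_minimizer: "norm (minimizer \<omega>) \<le> 1"
proof -
  have "norm (minimizer \<omega>) \<le> (\<Sum>k. (1/2) ^ (k + 1))"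
    unfolding minimizer_def using half_powers_sums[of 0]
    by (intro summable_norm_bound(2)[OF minimizer_term_norm]) (simp add: sums_iff)
  then show ?thesis using half_powers_sums[of 0] by (simp add: sums_iff)
qed

text \<open>Orthogonality across pieces as well as within them leaves a single term, which is why
  one point can serve all pieces.\<close>

lemma dir_inner_minimizer:
  assumes "i < T k"
  shows "dir \<omega> k i \<bullet> minimizer \<omega> = level k"
proof -
  have "(\<lambda>l. level l *\<^sub>R (\<Sum>j<T l. dir \<omega> l j)) sums minimizer \<omega>"
    unfolding minimizer_def using half_powers_sums[of 0]
    by (intro summable_sums summable_norm_bound(1)[OF minimizer_term_norm]) (simp add: sums_iff)
  from bounded_linear.sums[OF bounded_linear_inner_right this, of "dir \<omega> k i"]
  have "(\<lambda>l. level l * (\<Sum>j<T l. dir \<omega> k i \<bullet> dir \<omega> l j)) sums (dir \<omega> k i \<bullet> minimizer \<omega>)"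
    by (simp add: inner_sum_right)
  moreover have "(\<lambda>l. level l * (\<Sum>j<T l. dir \<omega> k i \<bullet> dir \<omega> l j)) = (\<lambda>l. if l = k then level l else 0)"
  proof
    fix l
    have "(\<Sum>j<T l. dir \<omega> k i \<bullet> dir \<omega> l j) = (\<Sum>j<T l. if i = j then of_bool (k = l) else 0)"
      by (intro sum.cong) (auto simp: dir_inner)
    then show "level l * (\<Sum>j<T l. dir \<omega> k i \<bullet> dir \<omega> l j) = (if l = k then level l else 0)"
      using assms by simp
  qed
  moreover have "(\<lambda>l. if l = k then level l else 0) sums level k" by (rule sums_single)
  ultimately show ?thesis using sums_unique2 by metis
qed

lemma piece_minimizer: "piece \<omega> k (minimizer \<omega>) = - width k"
  unfolding piece_def using width_le[of k]
  by (intro chain_min width_pos norm_minimizer dir_inner_minimizer) auto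

lemma minimizer_le: "obj \<omega> (minimizer \<omega>) \<le> obj \<omega> x"
proof (rule sums_le[OF _ obj_sums obj_sums])
  show "a k * piece \<omega> k (minimizer \<omega>) \<le> a k * piece \<omega> k x" for k
    unfolding piece_minimizer by (intro mult_left_mono piece_ge less_imp_le[OF a_pos])
qed

lemma inf_val_obj: "inf_val (obj \<omega>) = obj \<omega> (minimizer \<omega>)"
  unfolding inf_val_def by (intro cInf_eq_minimum) (auto intro: minimizer_le)

lemma obj_cvx_bd: "obj \<omega> \<in> cvx_bd"
proof -
  have "minimizer \<omega> \<in> argmin (obj \<omega>)"
    using minimizer_le by (auto simp: argmin_def is_arg_min_def not_less)
  then have "edist_set 0 (argmin (obj \<omega>)) \<le> ereal (norm (0 - minimizer \<omega>))"
    unfolding edist_set_def by (intro INF_lower)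
  also have "\<dots> \<le> 1" using norm_minimizer by simp
  finally have 1: "edist_set 0 (argmin (obj \<omega>)) \<le> 1" .
  have half: "(\<lambda>k. (1/2 :: real) ^ (k + 2)) sums (1/2)" using half_powers_sums[of 1] by simp
  have "- (1/2) \<le> obj \<omega> (minimizer \<omega>)"
  proof (rule sums_le[OF _ sums_minus[OF half] obj_sums])
    fix k
    have "a k * width k \<le> (1/2) ^ (k + 2) * 1"
      using a_le[of k] a_pos[of k] width_le[of k] width_pos[of k] by (intro mult_mono) auto
    then show "- ((1/2) ^ (k + 2)) \<le> a k * piece \<omega> k (minimizer \<omega>)" by (simp add: piece_minimizer)
  qed
  moreover have "obj \<omega> 0 \<le> 1/2"
  proof (rule sums_le[OF _ obj_sums half])
    fix k
    have "a k * piece \<omega> k 0 \<le> a k * 1"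
      using a_pos[of k] piece_at_0[of \<omega> k] level_le[of k] by (intro mult_left_mono) auto
    then show "a k * piece \<omega> k 0 \<le> (1/2) ^ (k + 2)" using a_le[of k] by simp
  qed
  moreover have "convex_on UNIV (obj \<omega>)" by (rule convex_on_if_subgradients[OF obj_lower])
  ultimately show ?thesis
    using 1 minimizer_le[of \<omega> 0] by (simp add: cvx_bd_def inf_val_obj)
qed

lemma obj_nonsmooth: "obj \<omega> \<in> nonsmooth_class"
  unfolding nonsmooth_class_def
  by (auto intro!: lipschitz_onI obj_cvx_bd simp: dist_norm obj_lipschitz)

lemma obj_smooth:
  assumes "\<And>k. a k * curvature k \<le> (1/2) ^ (k + 1)"
  shows "obj \<omega> \<in> smooth_class"
proof -
  have "1-lipschitz_on UNIV (obj_grad \<omega>)"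
    by (rule sandwiched_lipschitz[OF obj_sandwiched[OF assms]]) simp
  moreover have "\<forall>x. GDERIV (obj \<omega>) x :> obj_grad \<omega> x"
    using sandwiched_GDERIV[OF obj_sandwiched[OF assms]] by simp
  ultimately show ?thesis
    unfolding smooth_class_def using obj_cvx_bd lipschitz_on_continuous_on by blast
qed

text \<open>The pieces share a minimizer, so the gap is a series of nonnegative gaps and at least
  its \<open>k\<close>-th term.\<close>

lemma obj_gap:
  assumes "norm x \<ge> 6 \<or> \<bar>dir \<omega> k (T k - 1) \<bullet> x\<bar> \<le> width k"
  shows "a k * level k / 2 \<le> obj \<omega> x - inf_val (obj \<omega>)"
proof -
  have "(\<lambda>j. a j * piece \<omega> j x - a j * piece \<omega> j (minimizer \<omega>)) sums (obj \<omega> x - inf_val (obj \<omega>))"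
    unfolding inf_val_obj by (intro sums_diff obj_sums)
  then have sums: "(\<lambda>j. a j * (piece \<omega> j x + width j)) sums (obj \<omega> x - inf_val (obj \<omega>))"
    by (simp add: piece_minimizer distrib_left)
  have "level k / 2 \<le> piece \<omega> k x + width k"
    unfolding piece_def using assms width_T[of k] level_le[of k] T_pos[of k]
    by (intro chain_gap width_pos) auto
  then have "a k * level k / 2 \<le> (\<Sum>j\<in>{k}. a j * (piece \<omega> j x + width j))"
    using mult_left_mono[of _ _ "a k"] a_pos[of k] by fastforce
  also have "\<dots> \<le> (\<Sum>j. a j * (piece \<omega> j x + width j))"
  proof (rule sum_le_suminf)
    show "0 \<le> a j * (piece \<omega> j x + width j)" for j
      using a_pos[of j] piece_ge[of j \<omega> x] by simp
  qed (use sums in \<open>auto simp: sums_iff\<close>)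
  also have "\<dots> = obj \<omega> x - inf_val (obj \<omega>)" using sums by (simp add: sums_iff)
  finally show ?thesis .
qed



text \<open>Changing one label alters only piece \<open>k\<close>, and there only a direction after
  \<open>s\<close>, which \<open>chain_local\<close> hides at \<open>x\<close>.\<close>

lemma obj_local:
  assumes "s < i" "i < T k"
    and agree: "\<And>p. p \<noteq> (k, i) \<Longrightarrow> \<omega> p = \<omega>' p"
    and far: "norm x \<ge> 6 \<or> (\<forall>j. s \<le> j \<and> j < T k \<longrightarrow> \<bar>dir \<omega> k j \<bullet> x\<bar> \<le> width k \<and> \<bar>dir \<omega>' k j \<bullet> x\<bar> \<le> width k)"
  shows "obj \<omega> x = obj \<omega>' x" "obj_grad \<omega> x = obj_grad \<omega>' x"
proof -
  have other: "dir \<omega> l = dir \<omega>' l" if "l \<noteq> k" for l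
    using agree that by (auto simp: dir_def)
  have same: "dir \<omega> k j = dir \<omega>' k j" if "j \<le> s" for j
    using agree[of "(k, j)"] that assms(1) by (auto simp: dir_def)
  have "piece \<omega> l x = piece \<omega>' l x \<and> piece_grad \<omega> l x = piece_grad \<omega>' l x" for l
  proof (cases "l = k")
    case True
    have "width k \<le> 1/4" "0 \<le> level k" "level k \<le> 1" "s < T k"
      using width_le[of k] level_pos[of k] level_le[of k] assms(1,2) by auto
    note local = chain_local[OF width_pos this orthonormal_dir orthonormal_dir same far]
    show ?thesis unfolding True piece_def piece_grad_def using local by blast
  qed (simp add: piece_def piece_grad_def other)
  then show "obj \<omega> x = obj \<omega>' x" "obj_grad \<omega> x = obj_grad \<omega>' x"
    by (simp_all add: obj_def obj_grad_def)
qed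

end

subsection \<open>Lower bound for almost every objective\<close>

lemma closed_superset_dense:
  fixes C :: "'a::topological_space set"
  assumes "\<And>X :: 'a set. open X \<Longrightarrow> X \<noteq> {} \<Longrightarrow> \<exists>d\<in>D. d \<in> X" "closed C" "D \<subseteq> C"
  shows "x \<in> C"
  using assms(1)[of "- C"] assms(2,3) by auto

lemma one_le_limsup:
  fixes f :: "nat \<Rightarrow> ereal"
  assumes "\<And>n. \<exists>m\<ge>n. 1 \<le> f m"
  shows "1 \<le> limsup f"
  unfolding limsup_INF_SUP using assms by (intro INF_greatest) (auto intro: SUP_upper2)

context hard_instance
begin

text \<open>The subgradient inequality at the reflected point turns the bound on second differences
  into an upper bound on the quotient. \<open>K\<close> is fixed first to make the Lipschitz tail
  small, then \<open>n\<close> to make the curvature term small. Subgradients are thereby determined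
  by function values.\<close>

lemma flat_quotient_limit:
  assumes F: "F \<in> flat_functions" and v: "v \<in> subdifferential F x"
  shows "(\<lambda>n. real (Suc n) * (F (x + h /\<^sub>R real (Suc n)) - F x)) \<longlonglongrightarrow> v \<bullet> h"
proof (rule LIMSEQ_I)
  fix \<epsilon> :: real assume "\<epsilon> > 0"
  define A where "A K = (\<Sum>k<K. a k * curvature k)" for K
  have sub: "F x + v \<bullet> u \<le> F (x + u)" for u
    using v by (simp add: subdifferential_def) (metis add_diff_cancel_left')
  have "(\<lambda>K. 4 * (1/2) ^ (K + 1) * norm h) \<longlonglongrightarrow> 4 * 0 * norm h"
    by (intro tendsto_intros LIMSEQ_ignore_initial_segment LIMSEQ_power_zero) simp
  then obtain K where K: "4 * (1/2) ^ (K + 1) * norm h < \<epsilon> / 2"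
    using \<open>\<epsilon> > 0\<close> order_tendstoD(2)[of _ "4 * 0 * norm h" sequentially "\<epsilon> / 2"]
    by (fastforce simp: eventually_sequentially)
  have "(\<lambda>n. A K * (norm h)\<^sup>2 * inverse (real (Suc n))) \<longlonglongrightarrow> A K * (norm h)\<^sup>2 * 0"
    by (intro tendsto_intros LIMSEQ_inverse_real_of_nat)
  then obtain n0 where n0: "\<And>n. n \<ge> n0 \<Longrightarrow> A K * (norm h)\<^sup>2 * inverse (real (Suc n)) < \<epsilon> / 2"
    using \<open>\<epsilon> > 0\<close> order_tendstoD(2)[of _ "A K * (norm h)\<^sup>2 * 0" sequentially "\<epsilon> / 2"]
    by (fastforce simp: eventually_sequentially)
  show "\<exists>n0. \<forall>n\<ge>n0. norm (real (Suc n) * (F (x + h /\<^sub>R real (Suc n)) - F x) - v \<bullet> h) < \<epsilon>"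
  proof (intro exI allI impI)
    fix n assume "n \<ge> n0"
    define m where "m = real (Suc n)"
    define t where "t = inverse m"
    have t: "t > 0" "m > 0" "m * t = 1" by (simp_all add: t_def m_def)
    have low: "t * (v \<bullet> h) \<le> F (x + t *\<^sub>R h) - F x" using sub[of "t *\<^sub>R h"] by simp
    have "F (x + t *\<^sub>R h) + F (x - t *\<^sub>R h) - 2 * F x
        \<le> A K * (norm (t *\<^sub>R h))\<^sup>2 + 4 * (1/2) ^ (K + 1) * norm (t *\<^sub>R h)"
      using F unfolding flat_functions_def A_def by blast
    moreover have "F x - t * (v \<bullet> h) \<le> F (x - t *\<^sub>R h)" using sub[of "- (t *\<^sub>R h)"] by simp
    moreover have "A K * (norm (t *\<^sub>R h))\<^sup>2 + 4 * (1/2) ^ (K + 1) * norm (t *\<^sub>R h)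
        = t * (A K * (norm h)\<^sup>2 * t + 4 * (1/2) ^ (K + 1) * norm h)"
      using t(1) by (simp add: algebra_simps power2_eq_square)
    ultimately have up: "F (x + t *\<^sub>R h) - F x
        \<le> t * (v \<bullet> h + (A K * (norm h)\<^sup>2 * t + 4 * (1/2) ^ (K + 1) * norm h))"
      by (simp add: distrib_left)
    have "A K * (norm h)\<^sup>2 * t + 4 * (1/2) ^ (K + 1) * norm h < \<epsilon>"
      using n0[OF \<open>n \<ge> n0\<close>] K by (simp add: t_def m_def)
    then have up': "F (x + t *\<^sub>R h) - F x < t * (v \<bullet> h + \<epsilon>)"
      using up t(1) by (smt (verit) mult_strict_left_mono)
    have "m * (t * (v \<bullet> h)) \<le> m * (F (x + t *\<^sub>R h) - F x)"
      "m * (F (x + t *\<^sub>R h) - F x) < m * (t * (v \<bullet> h + \<epsilon>))"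
      using low up' t(2) by (auto intro!: mult_left_mono mult_strict_left_mono)
    then have "v \<bullet> h \<le> m * (F (x + t *\<^sub>R h) - F x)" "m * (F (x + t *\<^sub>R h) - F x) < v \<bullet> h + \<epsilon>"
      using t(3) by (simp_all only: mult.assoc[symmetric] mult_1)
    then show "norm (real (Suc n) * (F (x + h /\<^sub>R real (Suc n)) - F x) - v \<bullet> h) < \<epsilon>"
      unfolding m_def[symmetric] unfolding t_def[symmetric] real_norm_def using \<open>\<epsilon> > 0\<close> by linarith
  qed
qed

lemma obj_grad_subdifferential: "obj_grad \<omega> x \<in> subdifferential (obj \<omega>) x"
  using obj_lower[of \<omega> x "y - x" for y] by (simp add: subdifferential_def)

lemma obj_quotient_limit:
  "(\<lambda>n. real (Suc n) * (obj \<omega> (x + h /\<^sub>R real (Suc n)) - obj \<omega> x)) \<longlonglongrightarrow> obj_grad \<omega> x \<bullet> h"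
  by (rule flat_quotient_limit[OF obj_flat obj_grad_subdifferential])

lemma obj_grad_unique:
  assumes "v \<in> subdifferential (obj \<omega>) x"
  shows "v = obj_grad \<omega> x"
proof -
  have "v \<bullet> h = obj_grad \<omega> x \<bullet> h" for h
    by (rule LIMSEQ_unique[OF flat_quotient_limit[OF obj_flat assms] obj_quotient_limit])
  then show ?thesis using vector_eq_rdot by blast
qed

lemma sets_flat_functions:
  assumes cont: "\<And>F. F \<in> \<F> \<Longrightarrow> continuous_on UNIV F"
  shows "\<F> \<inter> flat_functions \<in> sets (fun_space \<F>)"
proof -
  obtain Q :: "'a set" where Q: "countable Q" "\<And>X. open X \<Longrightarrow> X \<noteq> {} \<Longrightarrow> \<exists>d\<in>Q. d \<in> X"
    by (erule countable_dense_setE)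
  define P where "P F K x h \<longleftrightarrow> F (x + h) + F (x - h) - 2 * F x
      \<le> (\<Sum>k<K. a k * curvature k) * (norm h)\<^sup>2 + 4 * (1/2) ^ (K + 1) * norm h" for F K and x h :: 'a
  have ext: "P F K x h" if F: "F \<in> \<F>" and *: "\<And>x h. x \<in> Q \<Longrightarrow> h \<in> Q \<Longrightarrow> P F K x h" for F K x h
  proof -
    have c: "continuous_on UNIV (\<lambda>y. F (g y))" if "continuous_on UNIV g" for g :: "'a \<Rightarrow> 'a"
      using continuous_on_compose2[OF cont[OF F] that] by simp
    have "closed {x. P F K x h}" "closed {h. P F K x h}" for x h
      unfolding P_def by (intro closed_Collect_le continuous_intros c)+
    note cl = this
    have "P F K x h" if "h \<in> Q" for x h
      using closed_superset_dense[OF Q(2) cl(1)[of h], of x] * that by auto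
    then show ?thesis using closed_superset_dense[OF Q(2) cl(2)[of x], of h] by auto
  qed
  have "\<F> \<inter> flat_functions = {F \<in> \<F>. \<forall>K. \<forall>x h. P F K x h}"
    unfolding flat_functions_def P_def by blast
  also have "\<dots> = {F \<in> \<F>. \<forall>K. \<forall>x\<in>Q. \<forall>h\<in>Q. P F K x h}" using ext by blast
  also have "\<dots> = {F \<in> space (fun_space \<F>). \<forall>K. \<forall>x\<in>Q. \<forall>h\<in>Q. P F K x h}"
    by (simp add: space_fun_space)
  also have "\<dots> \<in> sets (fun_space \<F>)"
    unfolding P_def
    by (intro sets.sets_Collect_countable_All sets.sets_Collect_countable_All'[OF _ Q(1)]
        borel_measurable_le borel_measurable_add borel_measurable_diff borel_measurable_times
        borel_measurable_const measurable_fun_space_eval)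
  finally show ?thesis .
qed

section \<open>Random labels and uninformed queries\<close>

text \<open>A query of norm below 6 correlates with at most \<open>36 / (width k)\<^sup>2\<close>
  candidates, there are at most \<open>(T k)\<^sup>2\<close> pairs of a query and a direction, and
  the failure probability should be \<open>(1/2) ^ k\<close>.\<close>

definition dim :: "nat \<Rightarrow> nat" where
  "dim k = nat \<lceil>36 / (width k)\<^sup>2 * (T k)\<^sup>2 * 2 ^ k\<rceil>"

definition params :: "(nat \<times> nat \<Rightarrow> nat) measure" where
  "params = (\<Pi>\<^sub>M p\<in>UNIV. measure_pmf (pmf_of_set {..<dim (fst p)}))"

lemma dim_ge: "36 / (width k)\<^sup>2 * (T k)\<^sup>2 * 2 ^ k \<le> dim k"
  unfolding dim_def by (rule real_nat_ceiling_ge)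

lemma dim_pos: "dim k > 0"
proof -
  have "0 < 36 / (width k)\<^sup>2 * (T k)\<^sup>2 * 2 ^ k" using width_pos[of k] T_pos[of k] by simp
  then show ?thesis using dim_ge[of k] by linarith
qed

lemma space_params: "space params = UNIV"
  by (simp add: params_def space_PiM)

sublocale params: prob_space params
  unfolding params_def by (intro prob_space_PiM prob_space_measure_pmf)

lemma measurable_coordinate: "(\<lambda>\<omega>. \<omega> p) \<in> params \<rightarrow>\<^sub>M count_space UNIV"
  unfolding params_def
  using measurable_component_singleton[of p UNIV "\<lambda>p. measure_pmf (pmf_of_set {..<dim (fst p)})"]
  by (simp cong: measurable_cong_sets)

text \<open>Redrawing the coordinate \<open>p\<close> independently leaves \<open>params\<close>
  invariant, so by Fubini all other labels may be fixed and the bad values of this one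
  counted.\<close>

lemma prob_le_if_slices:
  fixes c :: real
  assumes B: "B \<in> sets params"
    and slice: "\<And>\<omega>. card {j\<in>{..<dim (fst p)}. (\<omega>)(p := j) \<in> B} \<le> c"
  shows "measure params B \<le> c / dim (fst p)"
proof -
  let ?M = "\<lambda>p. measure_pmf (pmf_of_set {..<dim (fst p)})"
  let ?f = "\<lambda>(j, \<omega>). (\<omega>)(p := j)"
  interpret pair_prob_space "?M p" params ..
  have distr: "distr (?M p \<Otimes>\<^sub>M params) params ?f = params"
    using distr_pair_PiM_eq_PiM[of UNIV ?M p] unfolding params_def by (simp add: prob_space_measure_pmf)
  have f: "?f \<in> ?M p \<Otimes>\<^sub>M params \<rightarrow>\<^sub>M params"
    unfolding params_def split_beta' by (intro measurable_fun_upd[of UNIV UNIV]) auto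
  have "emeasure params B = emeasure (distr (?M p \<Otimes>\<^sub>M params) params ?f) B" by (simp only: distr)
  also have "\<dots> = emeasure (?M p \<Otimes>\<^sub>M params) (?f -` B \<inter> space (?M p \<Otimes>\<^sub>M params))"
    by (rule emeasure_distr[OF f B])
  also have "\<dots> = (\<integral>\<^sup>+ \<omega>. emeasure (?M p) ((\<lambda>j. (j, \<omega>)) -` (?f -` B \<inter> space (?M p \<Otimes>\<^sub>M params))) \<partial>params)"
    using f B by (intro emeasure_pair_measure_alt2 measurable_sets)
  also have "\<dots> \<le> (\<integral>\<^sup>+ \<omega>. ennreal (c / dim (fst p)) \<partial>params)"
  proof (intro nn_integral_mono)
    fix \<omega>
    have "(\<lambda>j. (j, \<omega>)) -` (?f -` B \<inter> space (?M p \<Otimes>\<^sub>M params)) = {j. (\<omega>)(p := j) \<in> B}"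
      by (auto simp: space_pair_measure space_params)
    moreover have "emeasure (?M p) {j. (\<omega>)(p := j) \<in> B} = card {j\<in>{..<dim (fst p)}. (\<omega>)(p := j) \<in> B} / dim (fst p)"
      using dim_pos[of "fst p"] by (subst emeasure_pmf_of_set) (auto simp: Int_def conj_commute)
    ultimately show "emeasure (?M p) ((\<lambda>j. (j, \<omega>)) -` (?f -` B \<inter> space (?M p \<Otimes>\<^sub>M params)))
        \<le> ennreal (c / dim (fst p))"
      using slice[of \<omega>] by (simp add: divide_right_mono ennreal_leI)
  qed
  also have "\<dots> = ennreal (c / dim (fst p))" by (simp add: params.emeasure_space_1)
  finally show ?thesis
    using order_trans[OF _ slice, of 0] by (simp add: params.emeasure_eq_measure)
qed

lemma measurable_piece: "(\<lambda>\<omega>. piece \<omega> k x) \<in> borel_measurable params"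
proof -
  define js where "js \<omega> = map (\<lambda>i. \<omega> (k, i)) [0..<T k]" for \<omega> :: "nat \<times> nat \<Rightarrow> nat"
  have "js \<in> params \<rightarrow>\<^sub>M count_space UNIV"
  proof (subst measurable_count_space_eq2_countable, intro conjI ballI)
    fix l
    have "js -` {l} \<inter> space params
        = {\<omega> \<in> space params. length l = T k \<and> (\<forall>i\<in>{..<T k}. \<omega> (k, i) \<in> {l ! i})}"
      by (auto simp: js_def list_eq_iff_nth_eq)
    also have "\<dots> \<in> sets params"
    proof (intro sets.sets_Collect_conj sets.sets_Collect_const sets.sets_Collect_countable_All')
      fix i show "{\<omega> \<in> space params. \<omega> (k, i) \<in> {l ! i}} \<in> sets params"
        using measurable_sets[OF measurable_coordinate, of "{l ! i}" "(k, i)"]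
        by (simp add: vimage_def Int_def conj_commute)
    qed auto
    finally show "js -` {l} \<inter> space params \<in> sets params" .
  qed auto
  then have "(\<lambda>\<omega>. chain (width k) (T k) (level k) (\<lambda>i. e (k, i, js \<omega> ! i)) x) \<in> borel_measurable params"
    by (rule measurable_compose) simp
  moreover have "piece \<omega> k x = chain (width k) (T k) (level k) (\<lambda>i. e (k, i, js \<omega> ! i)) x" for \<omega>
    unfolding piece_def by (rule chain_cong) (simp add: js_def dir_def)
  ultimately show ?thesis by simp
qed

lemma measurable_obj: "(\<lambda>\<omega>. obj \<omega> x) \<in> borel_measurable params"
  unfolding obj_def
  by (intro borel_measurable_suminf borel_measurable_times borel_measurable_const measurable_piece)

definition run :: "'a algorithm \<Rightarrow> real \<Rightarrow> nat \<Rightarrow> (nat \<times> nat \<Rightarrow> nat) \<Rightarrow> 'a" where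
  "run A \<xi> t \<omega> = iterate A \<xi> (obj \<omega>) (obj_grad \<omega>) t"

text \<open>Queries are numbered from \<open>1\<close>: an algorithm that has learned one direction per query knows
  \<open>dir \<omega> k j\<close> for \<open>j < t - 1\<close> when it makes query \<open>t\<close>.\<close>

definition uninformed :: "'a algorithm \<Rightarrow> real \<Rightarrow> nat \<Rightarrow> nat \<Rightarrow> (nat \<times> nat \<Rightarrow> nat) \<Rightarrow> bool" where
  "uninformed A \<xi> k t \<omega> \<longleftrightarrow> norm (run A \<xi> t \<omega>) \<ge> 6
      \<or> (\<forall>j. t - 1 \<le> j \<and> j < T k \<longrightarrow> \<bar>dir \<omega> k j \<bullet> run A \<xi> t \<omega>\<bar> \<le> width k)"

text \<open>Failure at query \<open>t\<close> after a clean history. With the other labels fixed,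
  the clean history makes query \<open>t\<close> the same for all values of the label
  \<open>(k, i)\<close> that fall into the event.\<close>

definition lucky :: "'a algorithm \<Rightarrow> real \<Rightarrow> nat \<Rightarrow> nat \<Rightarrow> nat \<Rightarrow> (nat \<times> nat \<Rightarrow> nat) set" where
  "lucky A \<xi> k t i = {\<omega>. (\<forall>s\<in>{1..<t}. uninformed A \<xi> k s \<omega>)
      \<and> norm (run A \<xi> t \<omega>) < 6 \<and> width k < \<bar>dir \<omega> k i \<bullet> run A \<xi> t \<omega>\<bar>}"

text \<open>Inductively both runs pose the same query and, being uninformed there, receive the same
  answer: query \<open>r < t\<close> exposes directions only up to \<open>r - 1\<close>, which
  precedes \<open>i\<close>.\<close>

lemma run_cong:
  assumes "t - 1 \<le> i" "i < T k"
    and agree: "\<And>p. p \<noteq> (k, i) \<Longrightarrow> \<omega> p = \<omega>' p"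
    and uninf: "\<forall>s\<in>{1..<t}. uninformed A \<xi> k s \<omega>" "\<forall>s\<in>{1..<t}. uninformed A \<xi> k s \<omega>'"
    and "s \<le> t"
  shows "run A \<xi> s \<omega> = run A \<xi> s \<omega>'"
  using \<open>s \<le> t\<close>
proof (induction s rule: less_induct)
  case (less s)
  have "obj \<omega> (run A \<xi> r \<omega>) = obj \<omega>' (run A \<xi> r \<omega>') \<and> obj_grad \<omega> (run A \<xi> r \<omega>) = obj_grad \<omega>' (run A \<xi> r \<omega>')"
    if r: "r \<in> {1..<s}" for r
  proof -
    have eq: "run A \<xi> r \<omega> = run A \<xi> r \<omega>'" using less.IH[of r] less.prems r by auto
    have "uninformed A \<xi> k r \<omega>" "uninformed A \<xi> k r \<omega>'" using uninf r less.prems by auto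
    then have far: "norm (run A \<xi> r \<omega>') \<ge> 6 \<or> (\<forall>j. r - 1 \<le> j \<and> j < T k \<longrightarrow>
        \<bar>dir \<omega> k j \<bullet> run A \<xi> r \<omega>'\<bar> \<le> width k \<and> \<bar>dir \<omega>' k j \<bullet> run A \<xi> r \<omega>'\<bar> \<le> width k)"
      unfolding uninformed_def eq by blast
    have "r - 1 < i" using r less.prems assms(1) by auto
    from obj_local[OF this assms(2) agree far] show ?thesis unfolding eq by blast
  qed
  then show ?case
    unfolding run_def iterate.simps[of A \<xi> _ _ s] by (intro arg_cong[of _ _ "A s"]) (auto simp: restrict_def)
qed

text \<open>All lucky values of the label lead to the query \<open>y\<close> of one of them, and a
  lucky candidate correlates with \<open>y\<close>, as few candidates do.\<close>

lemma lucky_slice: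
  assumes "t - 1 \<le> i" "i < T k"
  shows "card {j\<in>{..<dim k}. (\<omega>)((k, i) := j) \<in> lucky A \<xi> k t i} \<le> 36 / (width k)\<^sup>2"
proof (cases "{j\<in>{..<dim k}. (\<omega>)((k, i) := j) \<in> lucky A \<xi> k t i} = {}")
  case True
  then show ?thesis by (simp only: card.empty) simp
next
  case False
  then obtain j0 where j0: "(\<omega>)((k, i) := j0) \<in> lucky A \<xi> k t i" by auto
  define y where "y = run A \<xi> t ((\<omega>)((k, i) := j0))"
  have "width k < \<bar>e (k, i, j) \<bullet> y\<bar>" if "(\<omega>)((k, i) := j) \<in> lucky A \<xi> k t i" for j
  proof -
    have "run A \<xi> t ((\<omega>)((k, i) := j)) = y"
      unfolding y_def using that j0 by (intro run_cong[OF assms]) (auto simp: lucky_def)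
    then show ?thesis using that by (auto simp: lucky_def dir_def)
  qed
  then have "card {j\<in>{..<dim k}. (\<omega>)((k, i) := j) \<in> lucky A \<xi> k t i}
      \<le> card {j\<in>{..<dim k}. width k < \<bar>e (k, i, j) \<bullet> y\<bar>}"
    by (intro card_mono) auto
  also have "real \<dots> \<le> 6\<^sup>2 / (width k)\<^sup>2"
    using e j0 by (intro card_large_coefficients width_pos) (auto simp: orthonormal_def lucky_def y_def)
  finally show ?thesis by simp
qed

lemma measurable_run:
  assumes "randomized_first_order A" "t \<ge> 1"
  shows "run A \<xi> t \<in> borel_measurable params"
  unfolding run_def
  by (rule measurable_iterate[OF assms(1) _ measurable_obj continuous_obj obj_quotient_limit assms(2)]) simp

lemma measurable_dir_run:
  assumes "randomized_first_order A" "t \<ge> 1"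
  shows "(\<lambda>\<omega>. dir \<omega> k i \<bullet> run A \<xi> t \<omega>) \<in> borel_measurable params"
proof -
  have "(\<lambda>\<omega>. dir \<omega> k i) \<in> borel_measurable params"
    unfolding dir_def by (rule measurable_compose[OF measurable_coordinate]) simp
  then show ?thesis using measurable_run[OF assms] by (rule borel_measurable_inner)
qed

lemma sets_uninformed:
  assumes "randomized_first_order A" "t \<ge> 1"
  shows "{\<omega> \<in> space params. uninformed A \<xi> k t \<omega>} \<in> sets params"
  unfolding uninformed_def using measurable_run[OF assms] measurable_dir_run[OF assms] by measurable

lemma sets_lucky:
  assumes "randomized_first_order A" "t \<ge> 1"
  shows "lucky A \<xi> k t i \<in> sets params"
proof -
  have "lucky A \<xi> k t i = {\<omega> \<in> space params. (\<forall>s\<in>{1..<t}. uninformed A \<xi> k s \<omega>)}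
      \<inter> {\<omega> \<in> space params. norm (run A \<xi> t \<omega>) < 6 \<and> width k < \<bar>dir \<omega> k i \<bullet> run A \<xi> t \<omega>\<bar>}"
    by (auto simp: lucky_def space_params)
  moreover have "{\<omega> \<in> space params. (\<forall>s\<in>{1..<t}. uninformed A \<xi> k s \<omega>)} \<in> sets params"
    by (intro sets.sets_Collect_countable_All' sets_uninformed[OF assms(1)]) auto
  moreover have "{\<omega> \<in> space params. norm (run A \<xi> t \<omega>) < 6 \<and> width k < \<bar>dir \<omega> k i \<bullet> run A \<xi> t \<omega>\<bar>} \<in> sets params"
    using measurable_run[OF assms] measurable_dir_run[OF assms] by measurable
  ultimately show ?thesis by simp
qed

lemma prob_informed:
  assumes "randomized_first_order A"
  shows "measure params {\<omega> \<in> space params. \<not> (\<forall>t\<in>{1..T k}. uninformed A \<xi> k t \<omega>)} \<le> (1/2) ^ k"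
proof -
  let ?I = "SIGMA t:{1..T k}. {t - 1..<T k}"
  have sub: "{\<omega> \<in> space params. \<not> (\<forall>t\<in>{1..T k}. uninformed A \<xi> k t \<omega>)}
      \<subseteq> (\<Union>(t, i)\<in>?I. lucky A \<xi> k t i)"
  proof
    fix \<omega> assume "\<omega> \<in> {\<omega> \<in> space params. \<not> (\<forall>t\<in>{1..T k}. uninformed A \<xi> k t \<omega>)}"
    then obtain t where t: "t \<in> {1..T k}" "\<not> uninformed A \<xi> k t \<omega>" by blast
    \<comment> \<open>The least informed query has the clean history that \<open>lucky\<close>
      demands.\<close>
    define t0 where "t0 = (LEAST t. t \<in> {1..T k} \<and> \<not> uninformed A \<xi> k t \<omega>)"
    have t0: "t0 \<in> {1..T k}" "\<not> uninformed A \<xi> k t0 \<omega>"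
      unfolding t0_def using LeastI[of "\<lambda>t. t \<in> {1..T k} \<and> \<not> uninformed A \<xi> k t \<omega>" t] t by blast+
    have less: "uninformed A \<xi> k s \<omega>" if "s \<in> {1..<t0}" for s
      using not_less_Least[of s "\<lambda>t. t \<in> {1..T k} \<and> \<not> uninformed A \<xi> k t \<omega>"] that t0(1)
      unfolding t0_def[symmetric] by auto
    obtain i where i: "t0 - 1 \<le> i" "i < T k" "\<omega> \<in> lucky A \<xi> k t0 i"
      using t0(2) less unfolding uninformed_def[of A \<xi> k t0] lucky_def by (auto simp: not_le)
    then have "(t0, i) \<in> ?I" using t0(1) by simp
    then show "\<omega> \<in> (\<Union>(t, i)\<in>?I. lucky A \<xi> k t i)" using i(3) by blast
  qed
  have meas: "lucky A \<xi> k t i \<in> sets params" if "t \<in> {1..T k}" for t i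
    using sets_lucky[OF assms] that by auto
  have "measure params {\<omega> \<in> space params. \<not> (\<forall>t\<in>{1..T k}. uninformed A \<xi> k t \<omega>)}
      \<le> measure params (\<Union>(t, i)\<in>?I. lucky A \<xi> k t i)"
    using meas by (intro params.finite_measure_mono[OF sub] sets.finite_UN) auto
  also have "\<dots> \<le> (\<Sum>(t, i)\<in>?I. measure params (lucky A \<xi> k t i))"
    unfolding split_beta using meas
    by (intro params.finite_measure_subadditive_finite) auto
  also have "\<dots> \<le> (\<Sum>(t, i)\<in>?I. 36 / (width k)\<^sup>2 / dim k)"
  proof (intro sum_mono, clarify)
    fix t i assume "t \<in> {1..T k}" "i \<in> {t - 1..<T k}"
    then show "measure params (lucky A \<xi> k t i) \<le> 36 / (width k)\<^sup>2 / dim k"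
      using prob_le_if_slices[of "lucky A \<xi> k t i" "(k, i)" "36 / (width k)\<^sup>2"] meas lucky_slice by simp
  qed
  also have "\<dots> = card ?I * (36 / (width k)\<^sup>2 / dim k)" by simp
  also have "\<dots> \<le> (T k)\<^sup>2 * (36 / (width k)\<^sup>2 / dim k)"
  proof -
    have "card ?I \<le> card ({1..T k} \<times> {..<T k})" by (intro card_mono) auto
    also have "\<dots> = (T k)\<^sup>2" by (simp add: power2_eq_square)
    finally have "real (card ?I) \<le> real ((T k)\<^sup>2)" by (simp only: of_nat_le_iff)
    then show ?thesis by (rule mult_right_mono) simp
  qed
  also have "\<dots> \<le> (1/2) ^ k"
  proof -
    have "t * (C / d) \<le> (1/2) ^ k" if "C * t * 2 ^ k \<le> d" "d > 0" for t C d :: real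
      using that by (simp add: power_divide field_simps)
    from this[OF dim_ge] show ?thesis using dim_pos[of k] by simp
  qed
  finally show ?thesis .
qed

text \<open>Borel--Cantelli for a fixed seed. After \<open>T k - 1\<close> answers the output is
  query \<open>T k\<close>, and there \<open>uninformed\<close> still covers the last direction
  \<open>T k - 1\<close>.\<close>

lemma AE_slow:
  assumes "randomized_first_order A"
  shows "AE \<omega> in params. \<exists>K. \<forall>k\<ge>K. a k * level k / 2
      \<le> obj \<omega> (alg_output A \<xi> (obj \<omega>) (obj_grad \<omega>) (T k - 1)) - inf_val (obj \<omega>)"
proof -
  let ?B = "\<lambda>k. {\<omega> \<in> space params. \<not> (\<forall>t\<in>{1..T k}. uninformed A \<xi> k t \<omega>)}"
  have "?B k \<in> sets params" for k
    by (intro sets.sets_Collect_neg sets.sets_Collect_countable_All' sets_uninformed[OF assms]) auto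
  moreover have "summable (\<lambda>k. measure params (?B k))"
    by (rule summable_comparison_test'[OF summable_geometric[of "1/2 :: real"]])
      (use prob_informed[OF assms] in auto)
  ultimately have "AE \<omega> in params. eventually (\<lambda>k. \<omega> \<in> space params - ?B k) sequentially"
    by (intro borel_cantelli_AE1) (auto simp: params.emeasure_eq_measure)
  then show ?thesis
  proof eventually_elim
    case (elim \<omega>)
    then obtain K where K: "\<And>k. k \<ge> K \<Longrightarrow> \<omega> \<in> space params - ?B k"
      by (auto simp: eventually_sequentially)
    have "a k * level k / 2 \<le> obj \<omega> (alg_output A \<xi> (obj \<omega>) (obj_grad \<omega>) (T k - 1)) - inf_val (obj \<omega>)"
      if "k \<ge> K" for k
    proof (rule obj_gap)
      have "uninformed A \<xi> k (T k) \<omega>" using K[OF that] T_pos(1)[of k] by auto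
      moreover have "alg_output A \<xi> (obj \<omega>) (obj_grad \<omega>) (T k - 1) = run A \<xi> (T k) \<omega>"
        using T_pos(1)[of k] by (simp add: alg_output_def run_def)
      ultimately show "norm (alg_output A \<xi> (obj \<omega>) (obj_grad \<omega>) (T k - 1)) \<ge> 6
          \<or> \<bar>dir \<omega> k (T k - 1) \<bullet> alg_output A \<xi> (obj \<omega>) (obj_grad \<omega>) (T k - 1)\<bar> \<le> width k"
        using T_pos(1)[of k] by (auto simp: uninformed_def)
    qed
    then show ?case by blast
  qed
qed

section \<open>The law of the objective\<close>

definition obj_dist :: "('a \<Rightarrow> real) set \<Rightarrow> ('a \<Rightarrow> real) measure" where
  "obj_dist \<F> = distr params (fun_space \<F>) obj"

lemma measurable_obj_fun_space:
  assumes "\<And>\<omega>. obj \<omega> \<in> \<F>"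
  shows "obj \<in> params \<rightarrow>\<^sub>M fun_space \<F>"
  by (rule measurable_fun_spaceI[OF measurable_obj assms])

lemma prob_measure_on_obj_dist:
  assumes "\<And>\<omega>. obj \<omega> \<in> \<F>"
  shows "prob_measure_on \<F> (obj_dist \<F>)"
  unfolding prob_measure_on_def obj_dist_def
  using params.prob_space_distr[OF measurable_obj_fun_space[OF assms]] by simp

text \<open>\<open>T k > k\<close> makes the indices \<open>T k - 1\<close> unbounded, and
  \<open>rate\<close> compares the guaranteed gap with \<rho> there, so the quotient is at least 1
  infinitely often.\<close>

lemma slow_almost_surely:
  assumes A: "randomized_first_order A"
    and obj: "\<And>\<omega>. obj \<omega> \<in> \<F>"
    and S: "S \<in> sets (fun_space \<F>)" "\<And>\<omega>. obj \<omega> \<in> S"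
    and cont: "\<And>F. F \<in> S \<Longrightarrow> continuous_on UNIV F"
    and bdd: "\<And>F. F \<in> S \<Longrightarrow> bdd_below (range F)"
    and G: "\<And>F x v. F \<in> S \<Longrightarrow> (\<lambda>n. real (Suc n) * (F (x + v /\<^sub>R real (Suc n)) - F x)) \<longlonglongrightarrow> G F x \<bullet> v"
    and G_obj: "\<And>\<omega>. G (obj \<omega>) = obj_grad \<omega>"
    and T_ge: "\<And>k. T k > k"
    and rate: "\<And>k. 0 < \<rho> (real (T k - 1))" "\<And>k. \<rho> (real (T k - 1)) \<le> r (T k - 1) * (a k * level k / 2)"
  shows "slow_event r \<rho> A G (obj_dist \<F>) \<inter> UNIV \<times> S \<in> sets (seed_and_function (obj_dist \<F>))"
    and "measure (seed_and_function (obj_dist \<F>)) (slow_event r \<rho> A G (obj_dist \<F>) \<inter> UNIV \<times> S) = 1"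
proof -
  let ?D = "obj_dist \<F>" and ?E = "slow_event r \<rho> A G (obj_dist \<F>) \<inter> UNIV \<times> S"
  have sets_D: "sets ?D = sets (fun_space \<F>)" by (simp add: obj_dist_def)
  have prob: "prob_space ?D" using prob_measure_on_obj_dist[OF obj] by (simp add: prob_measure_on_def)
  show E: "?E \<in> sets (seed_and_function ?D)"
    using S(1) by (intro sets_slow_event[OF A sets_D _ cont bdd G]) (simp_all add: sets_D)
  show "measure (seed_and_function ?D) ?E = 1"
  proof (rule measure_seed_and_function_eq_1[OF prob E])
    fix \<xi> :: real
    have "AE \<omega> in params. (\<xi>, obj \<omega>) \<in> ?E"
      using AE_slow[OF A, of \<xi>]
    proof eventually_elim
      case (elim \<omega>)
      then obtain K where K: "\<And>k. k \<ge> K \<Longrightarrow> a k * level k / 2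
          \<le> obj \<omega> (alg_output A \<xi> (obj \<omega>) (obj_grad \<omega>) (T k - 1)) - inf_val (obj \<omega>)" by blast
      let ?q = "\<lambda>n. r n * (obj \<omega> (alg_output A \<xi> (obj \<omega>) (G (obj \<omega>)) n) - inf_val (obj \<omega>)) / \<rho> (real n)"
      have "1 \<le> limsup (\<lambda>n. ereal (?q n))"
      proof (rule one_le_limsup)
        fix n
        define k where "k = max K n"
        have pos: "0 < a k * level k / 2" using a_pos[of k] level_pos[of k] by simp
        \<comment> \<open>The sign of \<open>r\<close> at this index is read off the rate
          condition.\<close>
        have "0 < r (T k - 1) * (a k * level k / 2)" using rate[of k] by linarith
        then have "0 \<le> r (T k - 1)" using pos by (simp add: zero_less_mult_iff)
        then have "\<rho> (real (T k - 1)) \<le> r (T k - 1) * (obj \<omega> (alg_output A \<xi> (obj \<omega>) (obj_grad \<omega>) (T k - 1)) - inf_val (obj \<omega>))"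
          using rate(2)[of k] mult_left_mono[OF K[of k]] by (force simp: k_def)
        then have "1 \<le> ?q (T k - 1)" using rate(1)[of k] by (simp add: G_obj le_divide_eq)
        moreover have "T k - 1 \<ge> n"
        proof -
          have "n \<le> k" by (simp add: k_def)
          then show ?thesis using T_ge[of k] by linarith
        qed
        ultimately show "\<exists>m\<ge>n. 1 \<le> ereal (?q m)" by (intro exI[of _ "T k - 1"]) (simp add: one_ereal_def)
      qed
      then show ?case using S(2) obj by (simp add: slow_event_def space_seed_and_function[OF sets_D])
    qed
    moreover have "{F \<in> space (fun_space \<F>). (\<xi>, F) \<in> ?E} \<in> sets (fun_space \<F>)"
    proof -
      have "Pair \<xi> -` ?E \<in> sets ?D" using E unfolding seed_and_function_def by (rule sets_Pair1)
      moreover have "Pair \<xi> -` ?E = {F \<in> space (fun_space \<F>). (\<xi>, F) \<in> ?E}"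
        by (auto simp: slow_event_def space_seed_and_function[OF sets_D] space_fun_space)
      ultimately show ?thesis by (simp add: sets_D)
    qed
    ultimately show "AE F in ?D. (\<xi>, F) \<in> ?E"
      unfolding obj_dist_def by (subst AE_distr_iff[OF measurable_obj_fun_space[OF obj]])
  qed
qed

end

section \<open>Transfer to the two classes\<close>

lemma GDERIV_quotient_limit:
  assumes "GDERIV F x :> D"
  shows "(\<lambda>n. real (Suc n) * (F (x + v /\<^sub>R real (Suc n)) - F x)) \<longlonglongrightarrow> D \<bullet> v"
proof -
  have F: "(F has_derivative (\<lambda>h. h \<bullet> D)) (at (x + 0 *\<^sub>R v))" using assms by (simp add: gderiv_def)
  have "((\<lambda>t. x + t *\<^sub>R v) has_derivative (\<lambda>t. t *\<^sub>R v)) (at 0)"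
    by (auto intro!: derivative_eq_intros)
  from has_derivative_compose[OF this F]
  have "((\<lambda>t. F (x + t *\<^sub>R v)) has_real_derivative (v \<bullet> D)) (at 0)"
    by (rule has_derivative_imp_has_field_derivative) simp
  then have "((\<lambda>t. (F (x + t *\<^sub>R v) - F x) / t) \<longlongrightarrow> v \<bullet> D) (at 0)"
    by (simp add: DERIV_def)
  moreover have "filterlim (\<lambda>n. inverse (real (Suc n))) (at 0) sequentially"
    by (intro filterlim_atI LIMSEQ_inverse_real_of_nat) (auto intro!: always_eventually)
  ultimately have "(\<lambda>n. (F (x + inverse (real (Suc n)) *\<^sub>R v) - F x) / inverse (real (Suc n))) \<longlonglongrightarrow> v \<bullet> D"
    by (rule filterlim_compose)
  then show ?thesis by (simp only: divide_inverse inverse_inverse_eq mult.commute inner_commute)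
qed

text \<open>An empty set of minimizers would lie at distance \<open>\<infinity>\<close> from the
  origin, so a minimizer exists.\<close>

lemma cvx_bd_bdd_below:
  assumes "F \<in> cvx_bd"
  shows "bdd_below (range F)"
proof -
  have "argmin F \<noteq> {}"
  proof
    assume "argmin F = {}"
    then have "edist_set 0 (argmin F) = \<infinity>" by (simp add: edist_set_def top_ereal_def)
    then show False using assms by (simp add: cvx_bd_def)
  qed
  then obtain z where "\<And>x. F z \<le> F x" by (auto simp: argmin_def is_arg_min_def not_less)
  then show ?thesis by (intro bdd_belowI[of _ "F z"]) auto
qed

text \<open>Surjectivity supplies a point with value \<open>min c 1\<close>, and monotonicity passes
  to every integer beyond it.\<close>

lemma exists_small_value:
  assumes \<rho>_bij: "bij_betw \<rho> {1..} {0<..1::real}" and \<rho>_decreasing: "antimono_on {1..} \<rho>" and "c > 0"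
  shows "\<exists>n\<ge>m. \<rho> (real n) \<le> c"
proof -
  obtain x where x: "x \<ge> 1" "\<rho> x = min c 1"
    using \<rho>_bij \<open>c > 0\<close> by (metis bij_betw_iff_bijections atLeast_iff greaterThanAtMost_iff min.cobounded2 min_less_iff_conj zero_less_one)
  define n where "n = max m (nat \<lceil>x\<rceil>)"
  have "x \<le> real n" unfolding n_def by linarith
  then have "\<rho> (real n) \<le> \<rho> x" using x(1) by (intro monotone_onD[OF \<rho>_decreasing]) auto
  then show ?thesis using x(2) by (intro exI[of _ n]) (auto simp: n_def)
qed

theorem corollary4:
  fixes \<rho> :: "real \<Rightarrow> real" and \<delta> :: real
  assumes infinite_dim: "\<nexists>B :: 'a::{real_inner, polish_space} set. finite B \<and> span B = UNIV"
    and \<rho>_bij: "bij_betw \<rho> {1..} {0<..1}"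
    and \<rho>_decreasing: "antimono_on {1..} \<rho>"
    and \<delta>: "0 < \<delta>" "\<delta> \<le> 1/2"
  shows "(\<exists>D :: ('a \<Rightarrow> real) measure. prob_measure_on nonsmooth_class D \<and>
           (\<forall>A G. randomized_first_order A \<longrightarrow> subgradient_selection nonsmooth_class G \<longrightarrow>
              measure (completion (seed_and_function D)) (slow_event (\<lambda>n. sqrt (real n)) \<rho> A G D)
                \<ge> 1 - 2 * \<delta>))
       \<and> (\<exists>D :: ('a \<Rightarrow> real) measure. prob_measure_on smooth_class D \<and>
           (\<forall>A G. randomized_first_order A \<longrightarrow> gradient_map smooth_class G \<longrightarrow>
              measure (seed_and_function D) (slow_event (\<lambda>n. (real n)\<^sup>2) \<rho> A G D)
                \<ge> 1 - 2 * \<delta>))"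
proof -
  obtain e0 :: "nat \<Rightarrow> 'a" where e0: "orthonormal e0"
    using exists_orthonormal_sequence[OF infinite_dim] by blast
  define e where "e p = e0 (to_nat p)" for p :: "nat \<times> nat \<times> nat"
  have e: "orthonormal e" using e0 by (simp add: orthonormal_def e_def)
  \<comment> \<open>The bound lies below what remains in either case:
    \<open>(1/2) ^ (2 * k + 5)\<close> for nonsmooth and \<open>(1/2) ^ (3 * k + 3) / 384\<close>
    for smooth objectives.\<close>
  have "\<forall>k. \<exists>n\<ge>k + 1. \<rho> (real n) \<le> (1/2) ^ (3 * k + 12)"
    using exists_small_value[OF \<rho>_bij \<rho>_decreasing] by simp
  then obtain N :: "nat \<Rightarrow> nat" where N: "\<And>k. N k \<ge> k + 1" "\<And>k. \<rho> (real (N k)) \<le> (1/2) ^ (3 * k + 12)"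
    by metis
  \<comment> \<open>The output after \<open>N k\<close> oracle calls is query
    \<open>N k + 1\<close>, so a piece needs one direction more than there are answers.\<close>
  define T where "T k = N k + 1" for k
  have N_pos: "real (N k) \<ge> 1" for k using N(1)[of k] by simp
  have T_le: "real (T k) \<le> 2 * real (N k)" for k using N_pos[of k] by (simp add: T_def)

  have T2: "T k \<ge> 2" for k using N(1)[of k] by (simp add: T_def)
  have T_gt: "T k > k" for k using N(1)[of k] by (simp add: T_def)
  have T_N: "T k - 1 = N k" for k by (simp add: T_def)
  have \<rho>_pos: "0 < \<rho> (real (T k - 1))" for k
  proof -
    have "\<rho> (real (N k)) \<in> {0<..1}" using N_pos[of k] by (intro bspec[OF bij_betwE[OF \<rho>_bij]]) simp
    then show ?thesis unfolding T_N by simp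
  qed

  interpret ns: hard_instance e "\<lambda>k. (1/2) ^ (k + 2)" T
    by unfold_locales (auto simp: e T2)
  have ns_rate: "\<rho> (real (T k - 1)) \<le> sqrt (real (T k - 1)) * ((1/2) ^ (k + 2) * ns.level k / 2)" for k
  proof -
    have "sqrt (real (T k)) \<le> sqrt (2\<^sup>2 * real (N k))"
      using T_le[of k] N_pos[of k] by (intro real_sqrt_le_mono) simp
    then have "sqrt (real (T k)) \<le> 2 * sqrt (real (N k))" by (simp add: real_sqrt_mult)
    then have "1 / 2 \<le> sqrt (real (N k)) / sqrt (real (T k))"
      using T2[of k] by (simp add: field_simps)
    then have "(1/2) ^ (2 * k + 4) * (1 / 2) \<le> (1/2) ^ (2 * k + 4) * (sqrt (real (N k)) / sqrt (real (T k)))"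
      by (intro mult_left_mono) auto
    also have "\<dots> = sqrt (real (N k)) * ((1/2) ^ (k + 2) * ns.level k / 2)"
      by (simp add: ns.level_def power_add power_mult power4_eq_xxxx power2_eq_square mult_ac flip: power_mult_distrib)
    also have "(1/2) ^ (2 * k + 4) * (1/2) = (1/2 :: real) ^ Suc (2 * k + 4)" by (simp only: power_Suc2)
    also have "Suc (2 * k + 4) = 2 * k + 5" by simp
    finally have "(1/2) ^ (2 * k + 5) \<le> sqrt (real (N k)) * ((1/2) ^ (k + 2) * ns.level k / 2)" .
    moreover have "(1/2 :: real) ^ (3 * k + 12) \<le> (1/2) ^ (2 * k + 5)" by (intro power_decreasing) auto
    ultimately show ?thesis using N(2)[of k] by (simp only: T_N)
  qed
  have ns_measure: "measure (completion (seed_and_function (ns.obj_dist nonsmooth_class)))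
      (slow_event (\<lambda>n. sqrt (real n)) \<rho> A G (ns.obj_dist nonsmooth_class)) = 1"
    if A: "randomized_first_order A" and G: "subgradient_selection nonsmooth_class G" for A G
  proof -
    let ?D = "ns.obj_dist nonsmooth_class"
    let ?S = "nonsmooth_class \<inter> ns.flat_functions"
    have cont: "continuous_on UNIV F" if "F \<in> nonsmooth_class" for F :: "'a \<Rightarrow> real"
      using that by (auto simp: nonsmooth_class_def intro: lipschitz_on_continuous_on)
    \<comment> \<open>On the objectives the selection has no freedom, since their subgradients are
      unique.\<close>
    have "G (ns.obj \<omega>) x = ns.obj_grad \<omega> x" for \<omega> x
      using G ns.obj_nonsmooth by (intro ns.obj_grad_unique) (auto simp: subgradient_selection_def)
    then have G_obj: "G (ns.obj \<omega>) = ns.obj_grad \<omega>" for \<omega> by blast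
    have S: "?S \<in> sets (fun_space nonsmooth_class)" "ns.obj \<omega> \<in> ?S" for \<omega>
      using ns.sets_flat_functions[OF cont] ns.obj_nonsmooth ns.obj_flat by blast+
    have bdd: "bdd_below (range F)" if "F \<in> ?S" for F
      using that by (intro cvx_bd_bdd_below) (simp add: nonsmooth_class_def)
    have limit: "(\<lambda>n. real (Suc n) * (F (x + v /\<^sub>R real (Suc n)) - F x)) \<longlonglongrightarrow> G F x \<bullet> v"
      if "F \<in> ?S" for F x v
      using that G by (intro ns.flat_quotient_limit) (auto simp: subgradient_selection_def)
    have contS: "continuous_on UNIV F" if "F \<in> ?S" for F using that cont by blast
    note slow = ns.slow_almost_surely[where r = "\<lambda>n. sqrt (real n)", OF A ns.obj_nonsmooth S contS bdd limit
        G_obj T_gt \<rho>_pos ns_rate]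
    have "prob_space ?D"
      using ns.prob_measure_on_obj_dist[OF ns.obj_nonsmooth] by (simp add: prob_measure_on_def)
    then show ?thesis
      by (intro measure_completion_eq_1[OF prob_space_seed_and_function slow]) (auto simp: slow_event_def)
  qed

  \<comment> \<open>This is the width written out, because the weights must exist before the locale
    can be interpreted.\<close>
  define w where "w k = (1/2) ^ (k + 1) / sqrt (T k) / (16 * T k)" for k
  \<comment> \<open>The curvature is \<open>2 + 5 / (2 * w k)\<close>, and its product with
    \<open>w k\<close> is at most 3.\<close>
  define a where "a k = (1/2) ^ (k + 1) / 3 * w k" for k
  have w: "0 < w k \<and> w k \<le> 1" for k
  proof -
    have "w k \<le> (1/2) ^ (k + 1) / 1 / 1"
      unfolding w_def using T2[of k] by (intro frac_le) auto
    also have "\<dots> \<le> 1" by (simp add: power_le_one del: power_Suc)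
    finally show ?thesis using T2[of k] by (simp add: w_def)
  qed
  have a_le: "a k \<le> (1/2) ^ (k + 2)" for k
    using w[of k] mult_mono[of "(1/2) ^ (k + 1) / 3" "(1/2) ^ (k + 1) / 2" "w k" 1] by (simp add: a_def)
  interpret sm: hard_instance e a T
    by unfold_locales (use w a_le in \<open>auto simp: e T2 a_def\<close>)
  have width: "sm.width k = w k" for k by (simp add: sm.width_def sm.level_def w_def)
  have smooth: "a k * sm.curvature k \<le> (1/2) ^ (k + 1)" for k
  proof -
    have "w k * sm.curvature k = 2 * w k + 5 / 2"
      using w[of k] by (simp add: sm.curvature_def width distrib_left)
    also have "\<dots> \<le> 3" using sm.width_le[of k] by (simp add: width)
    finally have "(1/2) ^ (k + 1) / 3 * (w k * sm.curvature k) \<le> (1/2) ^ (k + 1) / 3 * 3"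
      by (intro mult_left_mono) auto
    then show ?thesis by (simp add: a_def mult.assoc)
  qed
  have sm_rate: "\<rho> (real (T k - 1)) \<le> (real (T k - 1))\<^sup>2 * (a k * sm.level k / 2)" for k
  proof -
    \<comment> \<open>The level enters once through the weight and once through the gap. The square
      contributes one factor \<open>1 / T k\<close> and the division inside the width another, which
      yields the rate \<open>1 / N\<^sup>2\<close>.\<close>
    have level: "sm.level k * sm.level k = (1/2) ^ (k + 1) * (1/2) ^ (k + 1) / T k"
      using T2[of k] by (simp add: sm.level_def)
    have "1 / 2 \<le> real (N k) / T k" using T_le[of k] T2[of k] by (simp add: field_simps)
    then have "(1 / 2)\<^sup>2 \<le> (real (N k) / T k)\<^sup>2" by (intro power_mono) auto
    \<comment> \<open>96 is the product of the 3 of the weight, the 16 of the width and the 2 of the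
      halved gap; the square of 1/2 turns it into 384, which is below \<open>2 ^ 9\<close>.\<close>
    then have "(1/2) ^ (3 * k + 3) / 96 * (1 / 2)\<^sup>2 \<le> (1/2) ^ (3 * k + 3) / 96 * (real (N k) / T k)\<^sup>2"
      by (intro mult_left_mono) auto
    also have "\<dots> = (real (N k))\<^sup>2 * ((1/2) ^ (k + 1) / 3 * (sm.level k * sm.level k) / (16 * T k) / 2)"
      unfolding level by (simp add: power_add power_mult power3_eq_cube power2_eq_square mult_ac flip: power_mult_distrib)
    also have "\<dots> = (real (N k))\<^sup>2 * (a k * sm.level k / 2)"
    proof -
      have "w k = sm.level k / (16 * T k)" by (simp add: w_def sm.level_def)
      then show ?thesis by (simp add: a_def)
    qed
    finally have "(1/2) ^ (3 * k + 3) / 384 \<le> (real (N k))\<^sup>2 * (a k * sm.level k / 2)"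
      by (simp add: power2_eq_square)
    moreover have "(1/2 :: real) ^ (3 * k + 12) \<le> (1/2) ^ (3 * k + 3) / 384"
      by (simp add: power_add power_one_over frac_le)
    ultimately show ?thesis using N(2)[of k] by (simp only: T_N)
  qed
  have sm_measure: "measure (seed_and_function (sm.obj_dist smooth_class))
      (slow_event (\<lambda>n. (real n)\<^sup>2) \<rho> A G (sm.obj_dist smooth_class)) = 1"
    if A: "randomized_first_order A" and G: "gradient_map smooth_class G" for A G
  proof -
    let ?D = "sm.obj_dist smooth_class"
    note obj = sm.obj_smooth[OF smooth]
    have limit: "(\<lambda>n. real (Suc n) * (F (x + v /\<^sub>R real (Suc n)) - F x)) \<longlonglongrightarrow> G F x \<bullet> v"
      if "F \<in> smooth_class" for F x v
      using that G by (intro GDERIV_quotient_limit) (auto simp: gradient_map_def)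
    have "G (sm.obj \<omega>) x \<bullet> v = sm.obj_grad \<omega> x \<bullet> v" for \<omega> x v
      by (rule LIMSEQ_unique[OF limit[OF obj] sm.obj_quotient_limit])
    then have G_obj: "G (sm.obj \<omega>) = sm.obj_grad \<omega>" for \<omega>
      using vector_eq_rdot by blast
    \<comment> \<open>Gradients are limits of quotients throughout this class, so \<open>S\<close>
      can be the whole class and the event itself is measurable.\<close>
    have S: "smooth_class \<in> sets (fun_space (smooth_class :: ('a \<Rightarrow> real) set))"
      using sets.top[of "fun_space (smooth_class :: ('a \<Rightarrow> real) set)"] by (simp add: space_fun_space)
    have cont: "continuous_on UNIV F" if "F \<in> smooth_class" for F :: "'a \<Rightarrow> real"
    proof -
      obtain g where "\<And>x. GDERIV F x :> g x" using \<open>F \<in> smooth_class\<close> by (auto simp: smooth_class_def)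
      then show ?thesis
        by (intro continuous_at_imp_continuous_on ballI has_derivative_continuous) (simp add: gderiv_def)
    qed
    have bdd: "bdd_below (range F)" if "F \<in> smooth_class" for F :: "'a \<Rightarrow> real"
      using that by (intro cvx_bd_bdd_below) (simp add: smooth_class_def)
    have "measure (seed_and_function ?D) (slow_event (\<lambda>n. (real n)\<^sup>2) \<rho> A G ?D \<inter> UNIV \<times> smooth_class) = 1"
      by (rule sm.slow_almost_surely(2)[where r = "\<lambda>n. (real n)\<^sup>2", OF A obj S obj cont bdd limit
            G_obj T_gt \<rho>_pos sm_rate])
    moreover have "sets ?D = sets (fun_space smooth_class)"
      using sm.prob_measure_on_obj_dist[OF obj] by (simp add: prob_measure_on_def)
    then have "slow_event (\<lambda>n. (real n)\<^sup>2) \<rho> A G ?D \<inter> UNIV \<times> smooth_class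
        = slow_event (\<lambda>n. (real n)\<^sup>2) \<rho> A G ?D"
      by (auto simp: slow_event_def space_seed_and_function)
    ultimately show ?thesis by simp
  qed
  show ?thesis
    using ns_measure ns.prob_measure_on_obj_dist[OF ns.obj_nonsmooth]
      sm_measure sm.prob_measure_on_obj_dist[OF sm.obj_smooth[OF smooth]] \<delta>
    by (intro conjI exI[of _ "ns.obj_dist nonsmooth_class"] exI[of _ "sm.obj_dist smooth_class"]) simp_all
qed

end
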